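(* There exist an absolute constant $c>0$ and, for every integer $k\ge 2$, a constant $c_k>0$ depending only on $k$, such that the following holds. Let $k\ge 2$ be an integer and let $\lambda,\mu_k,D,\epsilon>0$ satisfy $$D>\max\left\{\sqrt{3}\left(\frac{k!\,2^{\frac{k+3}{2}}\lambda}{\mu_k}\right)^{\frac{1}{k-1}},\ \sqrt{3}\,(12)^{\frac{3k+1}{2(k+1)}}\left(\frac{k!\,2^{\frac{k+3}{2}}\lambda}{\mu_k}\right)^{\frac{5}{4(2k-1)}}\right\}$$ and $$\epsilon<\min\left\{\left(\frac{(4\cdot k!)^2\lambda^{k+1}}{\mu_k^2}\right)^{\frac{1}{k-1}},\ \frac{\lambda}{8}\left(\frac{k!\,2^{\frac{k+3}{2}}\lambda}{\mu_k}\right)^{\frac{2}{k-1}}\right\}.$$ Then for every sufficiently large dimension $d$ (depending on $k,\lambda,\mu_k,D,\epsilon$) and every deterministic algorithm on $\mathbb{R}^d$ based on a $k$-th order oracle, there exists a function $f:\mathbb{R}^d\to\mathbb{R}$ such that: (i) $f$ is $\lambda$-strongly convex, $k$ times differentiable with $\mu_k$-Lipschitz $k$-th order derivative, and has a global minimum $x^*$ satisfying $\|x^1-x^*\|\le D$; (ii) where $x^1,x^2,\dots$ are the points produced by the algorithm when run on $f$, any index $T$ with $f(x^T)-f(x^* )\le\epsilon$ satisfies $$T\ \ge\ c\cdot\left(\left(\frac{\mu_k D^{k-1}}{3^{\frac{k-1}{2}}2^{\frac{k+3}{2}}k!\,\lambda}\right)^{\frac{2}{3k+1}}+\log_k\log\left(\left(\frac{(4\cdot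 k!)^2\lambda^{k+1}}{\mu_k^2}\right)^{\frac{1}{k-1}}\cdot\frac{1}{\epsilon}\right)\right).$$ Consequently (whenever the iterated logarithm below is defined), $$T\ \ge\ c_k\left(\left(\frac{\mu_k D^{k-1}}{\lambda}\right)^{\frac{2}{3k+1}}+\log\log\left(\frac{\lambda^{\frac{k+1}{k-1}}}{\mu_k^{\frac{2}{k-1}}}\cdot\frac{1}{\epsilon}\right)\right).$$
   Context: A $k$-th order oracle for $f:\mathbb{R}^d\to\mathbb{R}$, given a point $x\in\mathbb{R}^d$, returns $f(x),\nabla f(x),\nabla^2 f(x),\dots,\nabla^k f(x)$. A (deterministic) algorithm based on a $k$-th order oracle produces a sequence $x^1,x^2,\dots\in\mathbb{R}^d$, where each $x^t$ is a fixed deterministic function of the oracle's responses at $x^1,\dots,x^{t-1}$ (in particular $x^1$ is fixed by the algorithm, independently of $f$). $\|\cdot\|$ is the Euclidean norm on vectors. The $k$-th derivative is $\mu_k$-Lipschitz if $\|\nabla^k f(x)-\nabla^k f(y)\|\le\mu_k\|x-y\|$ for all $x,y$, where the norm of a $k$-tensor is the operator norm $\|A\|=\max_{\|z\|=1}\left|\sum_{i_1,\dots,i_k}A_{i_1,\dots,i_k}z_{i_1}\cdots z_{i_k}\right|$. A twice differentiable $f$ is $\lambda$-strongly convex if $\nabla^2 f(x)\succeq\lambda I$ for all $x$. $\log$ is the natural logarithm and $\log_k$ is the logarithm to base $k$. *)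

theory Defs
  imports "HOL-Analysis.Analysis"
begin

text \<open>
  The dimension \<open>d\<close> is quantified inside the theorem, so it cannot be a type. The space
  \<open>R^d\<close> is the carrier \<^term>\<open>topspace (Euclidean_space d)\<close>, that is, the set of
  sequences \<open>x :: nat \<Rightarrow> real\<close> with \<open>x i = 0\<close> for all \<open>i \<ge> d\<close>. A function on \<open>R^d\<close> has
  type \<open>(nat \<Rightarrow> real) \<Rightarrow> real\<close>; its values off the carrier are never used.
\<close>

type_synonym vec = "nat \<Rightarrow> real"

abbreviation Rd :: "nat \<Rightarrow> vec set" where
  "Rd d \<equiv> topspace (Euclidean_space d)"

definition enorm :: "nat \<Rightarrow> vec \<Rightarrow> real" where
  "enorm d x = L2_set x {..<d}"

definition edist :: "nat \<Rightarrow> vec \<Rightarrow> vec \<Rightarrow> real" where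
  "edist d x y = enorm d (\<lambda>i. x i - y i)"

text \<open>Frechet differentiability at \<open>x\<close>, in the form of \<open>has_derivative_within_alt\<close>.\<close>

definition has_gradient :: "nat \<Rightarrow> (vec \<Rightarrow> real) \<Rightarrow> vec \<Rightarrow> vec \<Rightarrow> bool" where
  "has_gradient d f g x \<longleftrightarrow>
     (\<forall>e>0. \<exists>\<delta>>0. \<forall>y\<in>Rd d. edist d y x < \<delta> \<longrightarrow>
        \<bar>f y - f x - (\<Sum>i<d. g i * (y i - x i))\<bar> \<le> e * edist d y x)"

definition partial :: "nat \<Rightarrow> (vec \<Rightarrow> real) \<Rightarrow> vec \<Rightarrow> real" where
  "partial i f x = deriv (\<lambda>t. f (x(i := t))) (x i)"

lemma has_gradient_imp_partial:
  assumes f: "has_gradient d f g x" and x: "x \<in> Rd d" and i: "i < d"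
  shows "partial i f x = g i"
proof -
  have dist: "edist d (x(i := t)) x = \<bar>t - x i\<bar>" for t
  proof -
    have "(\<Sum>j<d. ((x(i := t)) j - x j)\<^sup>2) = (\<Sum>j<d. if j = i then (t - x i)\<^sup>2 else 0)"
      by (rule sum.cong) auto
    then show ?thesis
      using i by (simp add: edist_def enorm_def L2_set_def)
  qed
  have lin: "(\<Sum>j<d. g j * ((x(i := t)) j - x j)) = g i * (t - x i)" for t
  proof -
    have "(\<Sum>j<d. g j * ((x(i := t)) j - x j)) = (\<Sum>j<d. if j = i then g i * (t - x i) else 0)"
      by (rule sum.cong) auto
    then show ?thesis
      using i by simp
  qed
  have mem: "x(i := t) \<in> Rd d" for t
    using x i by (auto simp: topspace_Euclidean_space)
  have "((\<lambda>t. f (x(i := t))) has_derivative (\<lambda>h. g i * h)) (at (x i))"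
    unfolding has_derivative_at_alt
  proof (intro conjI allI impI)
    fix e :: real assume "0 < e"
    then obtain \<delta> where "\<delta> > 0" and \<delta>: "\<And>y. y \<in> Rd d \<Longrightarrow> edist d y x < \<delta> \<Longrightarrow>
        \<bar>f y - f x - (\<Sum>i<d. g i * (y i - x i))\<bar> \<le> e * edist d y x"
      using f unfolding has_gradient_def by meson
    have "norm (f (x(i := t)) - f (x(i := x i)) - g i * (t - x i)) \<le> e * norm (t - x i)"
      if "norm (t - x i) < \<delta>" for t
      using \<delta>[OF mem, of t] that by (simp only: dist lin real_norm_def fun_upd_triv)
    then show "\<exists>\<delta>>0. \<forall>t. norm (t - x i) < \<delta> \<longrightarrow>
        norm (f (x(i := t)) - f (x(i := x i)) - g i * (t - x i)) \<le> e * norm (t - x i)"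
      using \<open>\<delta> > 0\<close> by blast
  qed (rule bounded_linear_mult_right)
  then have "((\<lambda>t. f (x(i := t))) has_field_derivative g i) (at (x i))"
    by (simp add: has_field_derivative_def)
  then show ?thesis
    unfolding partial_def by (rule DERIV_imp_deriv)
qed

text \<open>
  \<open>f\<close> is \<open>(k+1)\<close> times differentiable iff it is differentiable and every component of its
  gradient is \<open>k\<close> times differentiable.
\<close>

fun times_differentiable :: "nat \<Rightarrow> nat \<Rightarrow> (vec \<Rightarrow> real) \<Rightarrow> bool" where
  "times_differentiable d 0 f = True"
| "times_differentiable d (Suc k) f \<longleftrightarrow>
     (\<forall>x\<in>Rd d. \<exists>g. has_gradient d f g x) \<and> (\<forall>i<d. times_differentiable d k (partial i f))"

text \<open>
  A \<open>k\<close>-tensor is a function of multi-indices \<open>[i\<^sub>1, \<dots>, i\<^sub>k]\<close>. Outside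
  \<open>multi_indices d k\<close> the derivative tensor is set to \<open>0\<close>, so that it carries no further
  information about \<open>f\<close>.
\<close>

type_synonym tensor = "nat list \<Rightarrow> real"

definition multi_indices :: "nat \<Rightarrow> nat \<Rightarrow> nat list set" where
  "multi_indices d k = {is. set is \<subseteq> {..<d} \<and> length is = k}"

definition nabla :: "nat \<Rightarrow> nat \<Rightarrow> (vec \<Rightarrow> real) \<Rightarrow> vec \<Rightarrow> tensor" where
  "nabla d k f x = (\<lambda>is. if is \<in> multi_indices d k then foldr partial is f x else 0)"

definition tensor_norm :: "nat \<Rightarrow> nat \<Rightarrow> tensor \<Rightarrow> real" where
  "tensor_norm d k A =
     (SUP z\<in>{z\<in>Rd d. enorm d z = 1}. \<bar>\<Sum>is\<in>multi_indices d k. A is * (\<Prod>i\<leftarrow>is. z i)\<bar>)"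

definition lipschitz_nabla :: "nat \<Rightarrow> nat \<Rightarrow> real \<Rightarrow> (vec \<Rightarrow> real) \<Rightarrow> bool" where
  "lipschitz_nabla d k \<mu> f \<longleftrightarrow>
     (\<forall>x\<in>Rd d. \<forall>y\<in>Rd d.
        tensor_norm d k (\<lambda>is. nabla d k f x is - nabla d k f y is) \<le> \<mu> * edist d x y)"

definition strongly_convex :: "nat \<Rightarrow> real \<Rightarrow> (vec \<Rightarrow> real) \<Rightarrow> bool" where
  "strongly_convex d lam f \<longleftrightarrow> times_differentiable d 2 f \<and>
     (\<forall>x\<in>Rd d. \<forall>v\<in>Rd d.
        (\<Sum>i<d. \<Sum>j<d. v i * nabla d 2 f x [i, j] * v j) \<ge> lam * (\<Sum>i<d. (v i)\<^sup>2))"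

definition global_min :: "nat \<Rightarrow> (vec \<Rightarrow> real) \<Rightarrow> vec \<Rightarrow> bool" where
  "global_min d f x \<longleftrightarrow> x \<in> Rd d \<and> (\<forall>y\<in>Rd d. f x \<le> f y)"

type_synonym response = "tensor list"

definition oracle_response :: "nat \<Rightarrow> nat \<Rightarrow> (vec \<Rightarrow> real) \<Rightarrow> vec \<Rightarrow> response" where
  "oracle_response d k f x = map (\<lambda>j. nabla d j f x) [0..<Suc k]"

text \<open>
  A deterministic algorithm maps the list of the responses received so far to the next query
  point. The length of that list determines the number of the step, so this covers rules that
  differ from step to step. The queries are indexed from \<open>1\<close>.
\<close>

type_synonym algorithm = "response list \<Rightarrow> vec"

definition is_algorithm :: "nat \<Rightarrow> algorithm \<Rightarrow> bool" where
  "is_algorithm d \<A> \<longleftrightarrow> (\<forall>rs. \<A> rs \<in> Rd d)"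

fun query :: "nat \<Rightarrow> nat \<Rightarrow> algorithm \<Rightarrow> (vec \<Rightarrow> real) \<Rightarrow> nat \<Rightarrow> vec" where
  "query d k \<A> f t = \<A> (map (\<lambda>s. oracle_response d k f (query d k \<A> f s)) [1..<t])"

declare query.simps [simp del]

end

theory Submission
  imports Defs
begin

text \<open>
  For an orthonormal family \<open>v\<close> and the first query \<open>p\<close>, consider
  \<open>f x = (\<Sum>i. b i / (k + 1) * \<bar>\<langle>v i - v (i + 1), x - p\<rangle>\<bar> ^ (k + 1)) - \<gamma> * \<langle>v 0, x - p\<rangle> + lam / 2 * \<parallel>x - p\<parallel>\<^sup>2\<close>.
  At a point orthogonal (relative to \<open>p\<close>) to \<open>v j\<close> for all \<open>j \<ge> t\<close>, the derivatives up to order \<open>k\<close> only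
  involve \<open>v 0, \<dots>, v t\<close>, so an adversary can choose each \<open>v t\<close> orthogonal to the queries made so far:
  a query learns one new direction, and the \<open>T\<close>-th query has no component along \<open>v (T - 1)\<close>. By strong
  convexity its error is at least \<open>lam / 2\<close> times the squared coordinate of the minimizer along that direction.
  The weights \<open>b i \<le> \<beta>\<close> can be adjusted to prescribe the coordinates \<open>y i\<close> of the minimizer, provided
  \<open>lam * (\<Sum>j>i. y j) \<le> \<beta> * (y i - y (i + 1)) ^ k\<close>. A linear \<open>y\<close> gives the term polynomial in \<open>D\<close>, and
  \<open>y (i + 1)\<close> of order \<open>y i ^ k\<close> gives the iterated logarithm.
\<close>

subsection \<open>Vectors\<close>

definition ip :: "nat \<Rightarrow> vec \<Rightarrow> vec \<Rightarrow> real" where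
  "ip d x y = (\<Sum>i<d. x i * y i)"

abbreviation vdiff :: "vec \<Rightarrow> vec \<Rightarrow> vec" where
  "vdiff x y \<equiv> \<lambda>i. x i - y i"

lemma ip_commute: "ip d x y = ip d y x"
  by (simp add: ip_def mult.commute)

lemma ip_diff_left: "ip d (\<lambda>i. x i - y i) z = ip d x z - ip d y z"
  by (simp add: ip_def left_diff_distrib sum_subtractf)

lemma ip_diff_right: "ip d z (\<lambda>i. x i - y i) = ip d z x - ip d z y"
  by (simp add: ip_def right_diff_distrib sum_subtractf)

lemma ip_scale_left: "ip d (\<lambda>i. c * x i) y = c * ip d x y"
  by (simp add: ip_def sum_distrib_left mult.assoc)

lemma ip_scale_right: "ip d x (\<lambda>i. c * y i) = c * ip d x y"
  by (simp add: ip_commute[of d x] ip_scale_left)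

lemma ip_sum_left: "ip d (\<lambda>l. \<Sum>i\<in>I. g i l) y = (\<Sum>i\<in>I. ip d (g i) y)"
  unfolding ip_def sum_distrib_right by (rule sum.swap)

lemma ip_sum_right: "ip d y (\<lambda>l. \<Sum>i\<in>I. g i l) = (\<Sum>i\<in>I. ip d y (g i))"
  by (simp add: ip_commute[of d y] ip_sum_left)

lemma ip_self: "ip d x x = (enorm d x)\<^sup>2"
  by (simp add: ip_def enorm_def L2_set_def sum_nonneg power2_eq_square)

lemma enorm_nonneg: "0 \<le> enorm d x"
  by (simp add: enorm_def)

lemma ip_abs_le: "\<bar>ip d x y\<bar> \<le> enorm d x * enorm d y"
proof -
  have "\<bar>ip d x y\<bar> \<le> (\<Sum>i<d. \<bar>x i\<bar> * \<bar>y i\<bar>)"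
    unfolding ip_def by (rule order_trans[OF sum_abs]) (simp add: abs_mult)
  also have "\<dots> \<le> enorm d x * enorm d y"
    unfolding enorm_def by (rule L2_set_mult_ineq)
  finally show ?thesis .
qed

lemma ip_fun_upd:
  assumes "i < d"
  shows "ip d u (vdiff (x(i := t)) p) = ip d u (vdiff x p) + u i * (t - x i)"
proof -
  have "ip d u (vdiff (x(i := t)) p) - ip d u (vdiff x p)
      = (\<Sum>j<d. if j = i then u i * (t - x i) else 0)"
    unfolding ip_def sum_subtractf[symmetric] by (rule sum.cong) (auto simp: algebra_simps)
  then show ?thesis
    using assms by simp
qed

section \<open>Orthonormal families and the choice of a new orthogonal direction\<close>

definition orthonormal :: "nat \<Rightarrow> nat \<Rightarrow> (nat \<Rightarrow> vec) \<Rightarrow> bool" where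
  "orthonormal d n v \<longleftrightarrow> (\<forall>i<n. \<forall>j<n. ip d (v i) (v j) = (if i = j then 1 else 0))"

lemma orthonormal_ip_combination:
  assumes "orthonormal d n v" "j < n"
  shows "ip d (v j) (\<lambda>l. \<Sum>i<n. c i * v i l) = c j"
proof -
  have "ip d (v j) (\<lambda>l. \<Sum>i<n. c i * v i l) = (\<Sum>i<n. if i = j then c j else 0)"
    unfolding ip_sum_right ip_scale_right using assms
    by (intro sum.cong) (auto simp: orthonormal_def)
  then show ?thesis
    using assms by simp
qed

lemma orthonormal_norm_combination:
  assumes "orthonormal d n v"
  shows "(enorm d (\<lambda>l. \<Sum>i<n. c i * v i l))\<^sup>2 = (\<Sum>i<n. (c i)\<^sup>2)"
proof -
  have "ip d (\<lambda>l. \<Sum>i<n. c i * v i l) (\<lambda>l. \<Sum>i<n. c i * v i l)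
      = (\<Sum>j<n. c j * ip d (v j) (\<lambda>l. \<Sum>i<n. c i * v i l))"
    by (subst ip_sum_left) (simp add: ip_scale_left)
  also have "\<dots> = (\<Sum>i<n. (c i)\<^sup>2)"
    by (intro sum.cong) (auto simp: orthonormal_ip_combination[OF assms] power2_eq_square)
  finally show ?thesis
    by (simp add: ip_self)
qed

text \<open>The squared norm of \<open>z\<close> minus its projection \<open>w\<close> is
  nonnegative. The inequality serves twice: it controls the Lipschitz constant of the chain, and it
  bounds the distance to the minimizer from below by one coordinate.\<close>

lemma bessel:
  assumes "orthonormal d n v"
  shows "(\<Sum>i<n. (ip d (v i) z)\<^sup>2) \<le> (enorm d z)\<^sup>2"
proof -
  define w where "w = (\<lambda>l. \<Sum>i<n. ip d (v i) z * v i l)"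
  have ww: "ip d w w = (\<Sum>i<n. (ip d (v i) z)\<^sup>2)"
    using orthonormal_norm_combination[OF assms] unfolding ip_self w_def .
  have wz: "ip d w z = (\<Sum>i<n. (ip d (v i) z)\<^sup>2)"
    unfolding w_def ip_sum_left ip_scale_left by (simp add: power2_eq_square)
  have "0 \<le> ip d (vdiff z w) (vdiff z w)"
    by (simp add: ip_self)
  also have "\<dots> = ip d z z - 2 * ip d w z + ip d w w"
    by (simp add: ip_diff_left ip_diff_right ip_commute[of d z w])
  finally show ?thesis
    unfolding ww wz by (simp add: ip_self)
qed

text \<open>Gaussian elimination, one equation per induction step. Letting \<open>v\<close> vanish
  outside \<open>I\<close> makes a solution for \<open>I = {..<d}\<close> an element of
  \<open>Rd d\<close>.\<close>

lemma homogeneous_system_nontrivial: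
  fixes a :: "'j \<Rightarrow> 'i \<Rightarrow> real"
  assumes "finite J" "finite I" "card J < card I"
  shows "\<exists>v. (\<exists>i\<in>I. v i \<noteq> 0) \<and> (\<forall>i. i \<notin> I \<longrightarrow> v i = 0) \<and> (\<forall>j\<in>J. (\<Sum>i\<in>I. a j i * v i) = 0)"
  using assms
proof (induction J arbitrary: I a rule: finite_induct)
  case empty
  then obtain i where "i \<in> I" by fastforce
  then show ?case
    by (intro exI[of _ "\<lambda>l. if l = i then 1 else 0"]) auto
next
  case (insert j J)
  show ?case
  proof (cases "\<forall>i\<in>I. a j i = 0")
    case True
    have "card J < card I" using insert.prems insert.hyps by simp
    from insert.IH[OF insert.prems(1) this, of a] show ?thesis
      using True by auto
  next
    case False
    then obtain i0 where i0: "i0 \<in> I" "a j i0 \<noteq> 0" by auto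
    define I' where "I' = I - {i0}"
    have fin: "finite I'" "i0 \<notin> I'" and I: "I = insert i0 I'"
      using insert.prems i0 by (auto simp: I'_def)
    have "card J < card I'"
      using insert.prems insert.hyps i0 by (simp add: I'_def)
    \<comment> \<open>Subtracting a multiple of equation \<open>j\<close> from every other equation
      eliminates the pivot unknown \<open>i0\<close>.\<close>
    from insert.IH[OF fin(1) this, of "\<lambda>j' i. a j' i - a j' i0 / a j i0 * a j i"]
    obtain v where v: "\<exists>i\<in>I'. v i \<noteq> 0" "\<forall>i. i \<notin> I' \<longrightarrow> v i = 0"
      "\<forall>j'\<in>J. (\<Sum>i\<in>I'. (a j' i - a j' i0 / a j i0 * a j i) * v i) = 0"
      by blast
    \<comment> \<open>Back substitution: the value at \<open>i0\<close> that solves equation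
      \<open>j\<close>.\<close>
    define c where "c = - (\<Sum>i\<in>I'. a j i * v i) / a j i0"
    have split: "(\<Sum>i\<in>I. a j' i * (v(i0 := c)) i) = a j' i0 * c + (\<Sum>i\<in>I'. a j' i * v i)" for j'
    proof -
      have "(\<Sum>i\<in>I'. a j' i * (v(i0 := c)) i) = (\<Sum>i\<in>I'. a j' i * v i)"
        using fin by (intro sum.cong) auto
      then show ?thesis unfolding I using fin by simp
    qed
    have "(\<Sum>i\<in>I. a j' i * (v(i0 := c)) i) = 0" if "j' \<in> insert j J" for j'
    proof (cases "j' = j")
      case True
      then show ?thesis unfolding split unfolding c_def using i0 by simp
    next
      case False
      then have "(\<Sum>i\<in>I'. (a j' i - a j' i0 / a j i0 * a j i) * v i) = 0"
        using v(3) that by auto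
      moreover have "(\<Sum>i\<in>I'. (a j' i - a j' i0 / a j i0 * a j i) * v i)
          = (\<Sum>i\<in>I'. a j' i * v i) - a j' i0 / a j i0 * (\<Sum>i\<in>I'. a j i * v i)"
        by (simp add: left_diff_distrib sum_subtractf sum_distrib_left mult.assoc)
      ultimately show ?thesis unfolding split unfolding c_def by simp
    qed
    moreover have "\<exists>i\<in>I. (v(i0 := c)) i \<noteq> 0" using v(1) fin I by auto
    moreover have "\<forall>i. i \<notin> I \<longrightarrow> (v(i0 := c)) i = 0" using v(2) I by auto
    ultimately show ?thesis by blast
  qed
qed

lemma exists_unit_orthogonal:
  assumes "finite J" "card J < d"
  shows "\<exists>v\<in>Rd d. ip d v v = 1 \<and> (\<forall>j\<in>J. ip d (a j) v = 0)"
proof -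
  obtain v where v: "\<exists>i<d. v i \<noteq> 0" "\<forall>i\<ge>d. v i = 0" "\<forall>j\<in>J. ip d (a j) v = 0"
    using homogeneous_system_nontrivial[of J "{..<d}" a] assms unfolding ip_def
    by (auto simp: not_less)
  have pos: "ip d v v > 0"
    unfolding ip_def using v(1) by (auto intro!: sum_pos2 simp: zero_less_mult_iff linorder_neq_iff)
  define w where "w = (\<lambda>i. (1 / sqrt (ip d v v)) * v i)"
  have "ip d w w = 1"
    unfolding w_def ip_scale_left ip_scale_right using pos by simp
  moreover have "\<forall>j\<in>J. ip d (a j) w = 0"
    unfolding w_def ip_scale_right using v(3) by simp
  moreover have "w \<in> Rd d"
    using v(2) by (simp add: w_def topspace_Euclidean_space)
  ultimately show ?thesis by blast
qed

subsection \<open>Sums of ridge functions\<close>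

lemma has_gradient_zero: "has_gradient d (\<lambda>x. 0) (\<lambda>i. 0) x"
  unfolding has_gradient_def edist_def by (auto simp: enorm_nonneg intro!: exI[of _ 1])

lemma has_gradient_add:
  assumes "has_gradient d f1 g1 x" "has_gradient d f2 g2 x"
  shows "has_gradient d (\<lambda>x. f1 x + f2 x) (\<lambda>i. g1 i + g2 i) x"
  unfolding has_gradient_def
proof (intro allI impI)
  fix e :: real assume e: "e > 0"
  obtain d1 where d1: "d1 > 0" "\<And>y. y \<in> Rd d \<Longrightarrow> edist d y x < d1 \<Longrightarrow>
      \<bar>f1 y - f1 x - (\<Sum>i<d. g1 i * (y i - x i))\<bar> \<le> e/2 * edist d y x"
    using assms(1) e unfolding has_gradient_def by (meson half_gt_zero)
  obtain d2 where d2: "d2 > 0" "\<And>y. y \<in> Rd d \<Longrightarrow> edist d y x < d2 \<Longrightarrow>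
      \<bar>f2 y - f2 x - (\<Sum>i<d. g2 i * (y i - x i))\<bar> \<le> e/2 * edist d y x"
    using assms(2) e unfolding has_gradient_def by (meson half_gt_zero)
  have "\<bar>f1 y + f2 y - (f1 x + f2 x) - (\<Sum>i<d. (g1 i + g2 i) * (y i - x i))\<bar> \<le> e * edist d y x"
    if "y \<in> Rd d" "edist d y x < min d1 d2" for y
  proof -
    have "f1 y + f2 y - (f1 x + f2 x) - (\<Sum>i<d. (g1 i + g2 i) * (y i - x i))
        = (f1 y - f1 x - (\<Sum>i<d. g1 i * (y i - x i))) + (f2 y - f2 x - (\<Sum>i<d. g2 i * (y i - x i)))"
      by (simp add: distrib_right sum.distrib)
    also have "\<bar>\<dots>\<bar> \<le> e/2 * edist d y x + e/2 * edist d y x"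
      using d1(2)[of y] d2(2)[of y] that by (intro order_trans[OF abs_triangle_ineq] add_mono) auto
    finally show ?thesis by simp
  qed
  then show "\<exists>\<delta>>0. \<forall>y\<in>Rd d. edist d y x < \<delta> \<longrightarrow>
      \<bar>f1 y + f2 y - (f1 x + f2 x) - (\<Sum>i<d. (g1 i + g2 i) * (y i - x i))\<bar> \<le> e * edist d y x"
    using d1(1) d2(1) by (intro exI[of _ "min d1 d2"]) auto
qed

lemma has_gradient_sum:
  assumes "finite R" "\<And>r. r \<in> R \<Longrightarrow> has_gradient d (f r) (g r) x"
  shows "has_gradient d (\<lambda>x. \<Sum>r\<in>R. f r x) (\<lambda>i. \<Sum>r\<in>R. g r i) x"
  using assms by (induction R rule: finite_induct) (simp_all add: has_gradient_zero has_gradient_add)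

text \<open>The factor \<open>w\<close> stands for the product of the components of \<open>u\<close>
  along the directions already differentiated, so the form of a term survives further
  differentiation.\<close>

lemma has_gradient_ridge_term:
  assumes "(\<phi> has_real_derivative \<phi>') (at (ip d u (vdiff x p)))"
  shows "has_gradient d (\<lambda>x. \<phi> (ip d u (vdiff x p)) * w) (\<lambda>i. \<phi>' * (u i * w)) x"
  unfolding has_gradient_def
proof (intro allI impI)
  fix e :: real assume e: "e > 0"
  let ?t = "ip d u (vdiff x p)"
  \<comment> \<open>The summand 1 keeps the denominator positive even when \<open>u\<close> or
    \<open>w\<close> is zero.\<close>
  define M where "M = 1 + enorm d u * \<bar>w\<bar>"
  have M: "M > 0" by (simp add: M_def enorm_nonneg add_pos_nonneg)
  have U: "1 + enorm d u > 0" by (simp add: enorm_nonneg add_pos_nonneg)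
  have "(\<phi> has_derivative (*) \<phi>') (at ?t)"
    using assms by (simp add: has_field_derivative_def)
  then obtain \<delta> where \<delta>: "\<delta> > 0" "\<And>s. \<bar>s - ?t\<bar> < \<delta> \<Longrightarrow>
      \<bar>\<phi> s - \<phi> ?t - \<phi>' * (s - ?t)\<bar> \<le> e / M * \<bar>s - ?t\<bar>"
    using e M unfolding has_derivative_at_alt real_norm_def by (meson divide_pos_pos)
  have "\<bar>\<phi> (ip d u (vdiff y p)) * w - \<phi> ?t * w - (\<Sum>i<d. \<phi>' * (u i * w) * (y i - x i))\<bar>
      \<le> e * edist d y x" if y: "edist d y x < \<delta> / (1 + enorm d u)" for y
  proof -
    let ?s = "ip d u (vdiff y p)"
    have st: "?s - ?t = ip d u (vdiff y x)"
      by (simp add: ip_diff_right)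
    have le: "\<bar>?s - ?t\<bar> \<le> enorm d u * edist d y x"
      unfolding st edist_def by (rule ip_abs_le)
    have nn: "edist d y x \<ge> 0" by (simp add: edist_def enorm_nonneg)
    have "\<bar>?s - ?t\<bar> \<le> (1 + enorm d u) * edist d y x"
      using le nn by (simp add: algebra_simps)
    also have "\<dots> < \<delta>"
      using y U by (simp add: field_simps)
    finally have 1: "\<bar>\<phi> ?s - \<phi> ?t - \<phi>' * (?s - ?t)\<bar> \<le> e / M * \<bar>?s - ?t\<bar>"
      by (rule \<delta>(2))
    have lin: "(\<Sum>i<d. \<phi>' * (u i * w) * (y i - x i)) = \<phi>' * (?s - ?t) * w"
      unfolding st unfolding ip_def by (simp add: sum_distrib_left sum_distrib_right mult_ac)
    have "\<bar>\<phi> ?s * w - \<phi> ?t * w - \<phi>' * (?s - ?t) * w\<bar> = \<bar>\<phi> ?s - \<phi> ?t - \<phi>' * (?s - ?t)\<bar> * \<bar>w\<bar>"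
      by (simp add: abs_mult[symmetric] algebra_simps)
    also have "\<dots> \<le> e / M * (enorm d u * edist d y x) * \<bar>w\<bar>"
      using 1 le e M by (intro mult_right_mono order_trans[OF 1] mult_left_mono) auto
    also have "\<dots> = e * edist d y x * ((M - 1) / M)"
      by (simp add: M_def)
    also have "\<dots> \<le> e * edist d y x * 1"
      using M e nn by (intro mult_left_mono) auto
    finally show ?thesis unfolding lin by simp
  qed
  then show "\<exists>\<delta>>0. \<forall>y\<in>Rd d. edist d y x < \<delta> \<longrightarrow>
      \<bar>\<phi> (ip d u (vdiff y p)) * w - \<phi> ?t * w - (\<Sum>i<d. \<phi>' * (u i * w) * (y i - x i))\<bar> \<le> e * edist d y x"
    using \<delta>(1) U by (intro exI[of _ "\<delta> / (1 + enorm d u)"]) auto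
qed

text \<open>
  \<open>ridge\<close> is closed under partial derivatives: the index list records the directions already
  differentiated, and \<open>\<phi> r j\<close> stands for the \<open>j\<close>-th derivative of \<open>\<phi> r 0\<close>.
\<close>

definition ridge :: "nat \<Rightarrow> vec \<Rightarrow> 'r set \<Rightarrow> ('r \<Rightarrow> nat \<Rightarrow> real \<Rightarrow> real) \<Rightarrow> ('r \<Rightarrow> vec)
    \<Rightarrow> nat list \<Rightarrow> vec \<Rightarrow> real" where
  "ridge d p R \<phi> u is x =
     (\<Sum>r\<in>R. \<phi> r (length is) (ip d (u r) (vdiff x p)) * (\<Prod>i\<leftarrow>is. u r i))"

definition derivatives_upto :: "nat \<Rightarrow> ('r \<Rightarrow> nat \<Rightarrow> real \<Rightarrow> real) \<Rightarrow> bool" where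
  "derivatives_upto k \<phi> \<longleftrightarrow>
     (\<forall>r j t. j < k \<longrightarrow> (\<phi> r j has_real_derivative \<phi> r (Suc j) t) (at t))"

text \<open>The equation is between functions, not between values on \<open>Rd d\<close>, so that it
  can be rewritten below further \<open>partial\<close> operators.\<close>

lemma partial_ridge:
  assumes "derivatives_upto k \<phi>" "length is < k" "i < d"
  shows "partial i (ridge d p R \<phi> u is) = ridge d p R \<phi> u (i # is)"
proof
  fix x
  have "((\<lambda>t. ridge d p R \<phi> u is (x(i := t))) has_real_derivative ridge d p R \<phi> u (i # is) x)
      (at (x i))"
    unfolding ridge_def
  proof (rule DERIV_sum)
    fix r
    let ?t = "ip d (u r) (vdiff x p)"
    have "(\<phi> r (length is) has_real_derivative \<phi> r (Suc (length is)) ?t)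
        (at (?t + u r i * (x i - x i)))"
      using assms unfolding derivatives_upto_def by simp
    then have "((\<lambda>t. \<phi> r (length is) (?t + u r i * (t - x i))) has_real_derivative
        \<phi> r (Suc (length is)) ?t * u r i) (at (x i))"
      by (rule DERIV_chain2) (auto intro!: derivative_eq_intros)
    from DERIV_cmult_right[OF this, of "\<Prod>i\<leftarrow>is. u r i"]
    show "((\<lambda>t. \<phi> r (length is) (ip d (u r) (vdiff (x(i := t)) p)) * (\<Prod>i\<leftarrow>is. u r i))
        has_real_derivative \<phi> r (length (i # is)) ?t * (\<Prod>i\<leftarrow>i # is. u r i)) (at (x i))"
      unfolding ip_fun_upd[OF assms(3)] by (simp add: mult.assoc)
  qed
  then show "partial i (ridge d p R \<phi> u is) x = ridge d p R \<phi> u (i # is) x"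
    unfolding partial_def by (rule DERIV_imp_deriv)
qed

lemma foldr_partial_ridge:
  assumes "derivatives_upto k \<phi>" "length is \<le> k" "set is \<subseteq> {..<d}"
  shows "foldr partial is (ridge d p R \<phi> u []) = ridge d p R \<phi> u is"
  using assms(2,3) by (induction "is") (auto simp: partial_ridge[OF assms(1)])

lemma nabla_ridge:
  assumes "derivatives_upto k \<phi>" "j \<le> k"
  shows "nabla d j (ridge d p R \<phi> u []) x
    = (\<lambda>is. if is \<in> multi_indices d j then ridge d p R \<phi> u is x else 0)"
  using assms by (auto simp: nabla_def multi_indices_def foldr_partial_ridge)

lemma has_gradient_ridge:
  assumes "finite R" "derivatives_upto k \<phi>" "length is < k"
  shows "has_gradient d (ridge d p R \<phi> u is) (\<lambda>i. ridge d p R \<phi> u (i # is) x) x"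
  unfolding ridge_def list.map prod_list.Cons
proof (rule has_gradient_sum)
  show "has_gradient d (\<lambda>x. \<phi> r (length is) (ip d (u r) (vdiff x p)) * (\<Prod>i\<leftarrow>is. u r i))
      (\<lambda>i. \<phi> r (length (i # is)) (ip d (u r) (vdiff x p)) * (u r i * (\<Prod>i\<leftarrow>is. u r i))) x" for r
    using assms(2,3) unfolding derivatives_upto_def
    by (simp add: has_gradient_ridge_term)
qed fact

lemma times_differentiable_ridge:
  assumes "finite R" "derivatives_upto k \<phi>" "length is + j \<le> k"
  shows "times_differentiable d j (ridge d p R \<phi> u is)"
  using assms(3)
proof (induction j arbitrary: "is")
  case (Suc j)
  then have l: "length is < k" by simp
  then have "\<exists>g. has_gradient d (ridge d p R \<phi> u is) g x" for x
    using has_gradient_ridge[OF assms(1,2)] by blast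
  then show ?case
    using Suc by (simp add: partial_ridge[OF assms(2) l])
qed simp

section \<open>Tensor norm and Hessian of a ridge sum\<close>

lemma multi_indices_0: "multi_indices d 0 = {[]}"
  by (auto simp: multi_indices_def)

lemma multi_indices_Suc: "multi_indices d (Suc k) = (\<lambda>(i, is). i # is) ` ({..<d} \<times> multi_indices d k)"
  by (auto simp: multi_indices_def image_def length_Suc_conv)

text \<open>Expanding the product of \<open>k\<close> equal inner products gives one term per
  multi-index. This evaluates the rank-one tensor built from \<open>u\<close> at
  \<open>z\<close>.\<close>

lemma sum_multi_indices_prod:
  "(\<Sum>is\<in>multi_indices d k. (\<Prod>i\<leftarrow>is. u i) * (\<Prod>i\<leftarrow>is. z i)) = (ip d u z) ^ k"
proof (induction k)
  case (Suc k)
  have "(\<Sum>is\<in>multi_indices d (Suc k). (\<Prod>i\<leftarrow>is. u i) * (\<Prod>i\<leftarrow>is. z i))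
      = (\<Sum>(i, is)\<in>{..<d} \<times> multi_indices d k. u i * z i * ((\<Prod>i\<leftarrow>is. u i) * (\<Prod>i\<leftarrow>is. z i)))"
    unfolding multi_indices_Suc
    by (subst sum.reindex) (auto simp: inj_on_def mult_ac intro!: sum.cong)
  also have "\<dots> = ip d u z * (ip d u z) ^ k"
    unfolding Suc.IH[symmetric] by (simp add: ip_def sum_product sum.cartesian_product)
  finally show ?case by simp
qed (simp add: multi_indices_0)

text \<open>The \<open>k\<close>-th derivative of a ridge sum is a combination of rank-one tensors,
  so its form at \<open>z\<close> is a combination of \<open>k\<close>-th powers of inner
  products.\<close>

lemma tensor_norm_ridge_diff_le:
  assumes "derivatives_upto k \<phi>" "d > 0"
    and bound: "\<And>z. enorm d z = 1 \<Longrightarrow>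
      \<bar>\<Sum>r\<in>R. (\<phi> r k (ip d (u r) (vdiff x p)) - \<phi> r k (ip d (u r) (vdiff y p))) * (ip d (u r) z) ^ k\<bar> \<le> B"
  shows "tensor_norm d k (\<lambda>is. nabla d k (ridge d p R \<phi> u []) x is
      - nabla d k (ridge d p R \<phi> u []) y is) \<le> B"
  unfolding tensor_norm_def
proof (rule cSUP_least)
  \<comment> \<open>The supremum is bounded through \<open>cSUP_least\<close>, which asks for a
    nonempty set: for \<open>d > 0\<close> the unit sphere contains the first basis vector.\<close>
  have "(\<lambda>i. if i = 0 then 1 else 0) \<in> {z \<in> Rd d. enorm d z = 1}"
  proof -
    have "ip d (\<lambda>i. if i = 0 then 1 else 0) (\<lambda>i. if i = 0 then 1 else 0) = (\<Sum>i<d. if i = 0 then 1 else 0)"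
      unfolding ip_def by (rule sum.cong) auto
    then have "(enorm d (\<lambda>i. if i = 0 then 1 else 0))\<^sup>2 = 1"
      using assms(2) by (simp add: ip_self)
    then show ?thesis
      using assms(2) enorm_nonneg[of d] by (auto simp: topspace_Euclidean_space power2_eq_1_iff)
        (metis neg_0_le_iff_le not_one_le_zero)
  qed
  then show "{z \<in> Rd d. enorm d z = 1} \<noteq> {}" by blast
next
  fix z assume z: "z \<in> {z \<in> Rd d. enorm d z = 1}"
  let ?c = "\<lambda>r. \<phi> r k (ip d (u r) (vdiff x p)) - \<phi> r k (ip d (u r) (vdiff y p))"
  have "(\<Sum>is\<in>multi_indices d k. (nabla d k (ridge d p R \<phi> u []) x is
      - nabla d k (ridge d p R \<phi> u []) y is) * (\<Prod>i\<leftarrow>is. z i))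
      = (\<Sum>is\<in>multi_indices d k. \<Sum>r\<in>R. ?c r * ((\<Prod>i\<leftarrow>is. u r i) * (\<Prod>i\<leftarrow>is. z i)))"
  proof (rule sum.cong)
    fix "is" assume i: "is \<in> multi_indices d k"
    then have l: "length is = k" by (simp add: multi_indices_def)
    show "(nabla d k (ridge d p R \<phi> u []) x is - nabla d k (ridge d p R \<phi> u []) y is) * (\<Prod>i\<leftarrow>is. z i)
        = (\<Sum>r\<in>R. ?c r * ((\<Prod>i\<leftarrow>is. u r i) * (\<Prod>i\<leftarrow>is. z i)))"
      using i by (simp add: nabla_ridge[OF assms(1)] ridge_def l sum_subtractf[symmetric]
          sum_distrib_right left_diff_distrib mult.assoc)
  qed simp
  also have "\<dots> = (\<Sum>r\<in>R. ?c r * (ip d (u r) z) ^ k)"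
    by (subst sum.swap) (simp add: sum_distrib_left[symmetric] sum_multi_indices_prod)
  finally show "\<bar>\<Sum>is\<in>multi_indices d k. (nabla d k (ridge d p R \<phi> u []) x is
      - nabla d k (ridge d p R \<phi> u []) y is) * (\<Prod>i\<leftarrow>is. z i)\<bar> \<le> B"
    using bound z by simp
qed

lemma hessian_ridge:
  assumes "derivatives_upto k \<phi>" "2 \<le> k"
  shows "(\<Sum>i<d. \<Sum>j<d. w i * nabla d 2 (ridge d p R \<phi> u []) x [i, j] * w j)
    = (\<Sum>r\<in>R. \<phi> r 2 (ip d (u r) (vdiff x p)) * (ip d (u r) w)\<^sup>2)"
proof -
  have "(\<Sum>i<d. \<Sum>j<d. w i * nabla d 2 (ridge d p R \<phi> u []) x [i, j] * w j)
      = (\<Sum>i<d. \<Sum>j<d. \<Sum>r\<in>R. \<phi> r 2 (ip d (u r) (vdiff x p)) * ((u r i * w i) * (u r j * w j)))"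
    unfolding nabla_ridge[OF assms]
    by (intro sum.cong refl)
      (simp add: multi_indices_def ridge_def sum_distrib_left
        sum_distrib_right numeral_2_eq_2 mult_ac)
  also have "\<dots> = (\<Sum>i<d. \<Sum>r\<in>R. \<Sum>j<d. \<phi> r 2 (ip d (u r) (vdiff x p)) * ((u r i * w i) * (u r j * w j)))"
    by (intro sum.cong refl sum.swap)
  also have "\<dots> = (\<Sum>r\<in>R. \<Sum>i<d. \<Sum>j<d. \<phi> r 2 (ip d (u r) (vdiff x p)) * ((u r i * w i) * (u r j * w j)))"
    by (rule sum.swap)
  also have "\<dots> = (\<Sum>r\<in>R. \<phi> r 2 (ip d (u r) (vdiff x p)) * (ip d (u r) w)\<^sup>2)"
    by (simp add: ip_def power2_eq_square sum_product sum_distrib_left[symmetric])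
  finally show ?thesis .
qed

subsection \<open>Powers of the absolute value\<close>

definition signed_id :: "nat \<Rightarrow> real \<Rightarrow> real" where
  "signed_id k t = (if even k then \<bar>t\<bar> else t)"

text \<open>
  The \<open>j\<close>-th derivative of \<open>\<bar>t\<bar> ^ (k + 1) / (k + 1)\<close>, for \<open>j \<le> k\<close>; the factor \<open>signed_id\<close>
  treats both parities of \<open>k\<close> at once.
\<close>

definition abs_power :: "nat \<Rightarrow> nat \<Rightarrow> real \<Rightarrow> real" where
  "abs_power k j t = fact k / fact (k + 1 - j) * (t ^ (k - j) * signed_id k t)"

lemma abs_power_at_zero: "abs_power k j 0 = 0"
  by (simp add: abs_power_def signed_id_def)

text \<open>For even \<open>k\<close> the function \<open>signed_id k\<close> has a kink at 0. The
  additional factor \<open>t\<close> removes it, because the difference quotient at 0 becomes the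
  absolute value of \<open>h\<close>.\<close>

lemma DERIV_id_mult_signed_id:
  "((\<lambda>t. t * signed_id k t) has_real_derivative 2 * signed_id k t) (at t)"
proof (cases "even k")
  case True
  show ?thesis
  proof (cases "t = 0")
    case True
    have "((\<lambda>h::real. \<bar>h\<bar>) \<longlongrightarrow> 0) (at 0)"
      by (rule tendsto_eq_intros) (auto intro!: tendsto_eq_intros)
    then have "((\<lambda>h::real. h * \<bar>h\<bar> / h) \<longlongrightarrow> 0) (at 0)"
      by (rule Lim_transform_eventually) (auto simp: eventually_at_filter)
    then show ?thesis
      using \<open>even k\<close> True by (simp add: signed_id_def has_field_derivative_iff)
  next
    case False
    \<comment> \<open>The open half-line around \<open>t\<close> on which the absolute value is
      linear.\<close>
    define S where "S = (if t > 0 then {0<..} else {..<(0::real)})"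
    have "((\<lambda>x. sgn t * x\<^sup>2) has_real_derivative 2 * \<bar>t\<bar>) (at t)"
      by (auto intro!: derivative_eq_intros simp: abs_sgn[of t])
    then have "((\<lambda>t::real. t * \<bar>t\<bar>) has_real_derivative 2 * \<bar>t\<bar>) (at t)"
      by (rule has_field_derivative_transform_within_open[where S = S])
        (use False in \<open>auto simp: S_def sgn_if power2_eq_square split: if_splits\<close>)
    then show ?thesis
      using \<open>even k\<close> by (simp add: signed_id_def)
  qed
next
  case False
  then show ?thesis
    unfolding signed_id_def by (auto intro!: derivative_eq_intros)
qed

lemma DERIV_abs_power:
  assumes "j < k"
  shows "(abs_power k j has_real_derivative abs_power k (Suc j) t) (at t)"
proof -
  \<comment> \<open>As \<open>j < k\<close>, a factor \<open>t\<close> is available to be paired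
    with \<open>signed_id k t\<close>; an ordinary power \<open>t ^ m\<close> remains.\<close>
  define m where "m = k - Suc j"
  have m: "k - j = Suc m" "k + 1 - j = Suc (Suc m)" "k + 1 - Suc j = Suc m" "k - Suc j = m"
    using assms by (auto simp: m_def)
  have pow: "((\<lambda>t. t ^ m * (t * signed_id k t)) has_real_derivative
      real (m + 2) * (t ^ m * signed_id k t)) (at t)"
    by (rule DERIV_cong[OF DERIV_mult[OF DERIV_pow DERIV_id_mult_signed_id]])
      (cases m; simp add: algebra_simps)
  have "((\<lambda>t. fact k / fact (Suc (Suc m)) * (t ^ m * (t * signed_id k t))) has_real_derivative
      fact k / fact (Suc (Suc m)) * (real (m + 2) * (t ^ m * signed_id k t))) (at t)"
    by (rule DERIV_cmult[OF pow])
  moreover have "fact k / fact (Suc (Suc m)) * (real (m + 2) * (t ^ m * signed_id k t))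
      = fact k / fact (Suc m) * (t ^ m * signed_id k t)"
    by (simp add: fact_Suc[of "Suc m"] del: fact_Suc)
  ultimately show ?thesis
    unfolding abs_power_def m by (simp add: mult_ac)
qed

lemma abs_power_1_nonneg_arg:
  assumes "t \<ge> 0" "k \<ge> 1"
  shows "abs_power k 1 t = t ^ k"
proof -
  obtain m where "k = Suc m" using assms by (cases k) auto
  then show ?thesis
    using assms by (simp add: abs_power_def signed_id_def)
qed

lemma abs_power_2_nonneg:
  assumes "k \<ge> 2"
  shows "abs_power k 2 t \<ge> 0"
  using assms
  by (cases "even k") (auto simp: abs_power_def signed_id_def zero_le_even_power
      power_Suc2[symmetric] simp del: power_Suc)

lemma abs_power_above_tangent:
  assumes "k \<ge> 2"
  shows "abs_power k 0 t \<ge> abs_power k 0 s + abs_power k 1 s * (t - s)"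
proof -
  have "convex_on UNIV (abs_power k 0)"
  proof (rule f''_ge0_imp_convex[where f' = "abs_power k 1" and f'' = "abs_power k 2"])
    show "(abs_power k 0 has_real_derivative abs_power k 1 x) (at x)" for x
      using DERIV_abs_power[of 0 k x] assms by simp
    show "(abs_power k 1 has_real_derivative abs_power k 2 x) (at x)" for x
      using DERIV_abs_power[of 1 k x] assms by (simp add: numeral_2_eq_2)
  qed (use abs_power_2_nonneg[OF assms] in auto)
  then have "abs_power k 0 t - abs_power k 0 s \<ge> abs_power k 1 s * (t - s)"
    using DERIV_abs_power[of 0 k s] assms
    by (intro convex_on_imp_above_tangent[of UNIV]) auto
  then show ?thesis by simp
qed

text \<open>For \<open>j = k\<close> the power of \<open>t\<close> is trivial, leaving
  \<open>fact k * signed_id k\<close>, and \<open>signed_id k\<close> is 1-Lipschitz for either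
  parity.\<close>

lemma abs_power_k_lipschitz: "\<bar>abs_power k k s - abs_power k k t\<bar> \<le> fact k * \<bar>s - t\<bar>"
  by (auto simp: abs_power_def signed_id_def right_diff_distrib[symmetric] abs_mult)

subsection \<open>The hard function\<close>

text \<open>\<open>Inl 0\<close> carries the linear term, \<open>Inl (Suc i)\<close> the link
  between \<open>v i\<close> and \<open>v (Suc i)\<close>. The coordinate axes \<open>Inr l\<close>
  turn the quadratic term into ridge functions too, so all three kinds of term share one
  calculus.\<close>

fun chain_dir :: "(nat \<Rightarrow> vec) \<Rightarrow> nat + nat \<Rightarrow> vec" where
  "chain_dir v (Inl 0) = v 0"
| "chain_dir v (Inl (Suc i)) = vdiff (v i) (v (Suc i))"
| "chain_dir v (Inr l) = (\<lambda>i. if i = l then 1 else 0)"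

fun chain_profile :: "nat \<Rightarrow> real \<Rightarrow> real \<Rightarrow> (nat \<Rightarrow> real) \<Rightarrow> nat + nat \<Rightarrow> nat \<Rightarrow> real \<Rightarrow> real" where
  "chain_profile k lam \<gamma> b (Inl 0) j t = - \<gamma> * (if j = 0 then t else if j = 1 then 1 else 0)"
| "chain_profile k lam \<gamma> b (Inl (Suc i)) j t = b i * abs_power k j t"
| "chain_profile k lam \<gamma> b (Inr l) j t =
     lam * (if j = 0 then t\<^sup>2 / 2 else if j = 1 then t else if j = 2 then 1 else 0)"

lemma ip_chain_dir_Inr: "l < d \<Longrightarrow> ip d (chain_dir v (Inr l)) x = x l"
proof -
  assume "l < d"
  have "ip d (chain_dir v (Inr l)) x = (\<Sum>i<d. if i = l then x l else 0)"
    unfolding ip_def by (rule sum.cong) auto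
  then show ?thesis using \<open>l < d\<close> by simp
qed

lemma derivatives_upto_chain_profile: "derivatives_upto k (chain_profile k lam \<gamma> b)"
  unfolding derivatives_upto_def
proof (intro allI impI)
  fix r :: "nat + nat" and j t assume j: "j < k"
  consider "r = Inl 0" | i where "r = Inl (Suc i)" | l where "r = Inr l"
    by (metis sum.exhaust not0_implies_Suc)
  then show "(chain_profile k lam \<gamma> b r j has_real_derivative chain_profile k lam \<gamma> b r (Suc j) t) (at t)"
  proof cases
    case 1
    show ?thesis
      unfolding 1 chain_profile.simps
      by (cases j) (auto intro!: derivative_eq_intros)
  next
    case 2
    show ?thesis
      unfolding 2 chain_profile.simps by (intro DERIV_cmult DERIV_abs_power j)
  next
    case 3
    consider "j = 0" | "j = 1" | "j \<ge> 2" by linarith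
    then show ?thesis
      unfolding 3 chain_profile.simps
      by cases (auto intro!: derivative_eq_intros)
  qed
qed

definition chain_fun :: "nat \<Rightarrow> nat \<Rightarrow> vec \<Rightarrow> real \<Rightarrow> real \<Rightarrow> (nat \<Rightarrow> real) \<Rightarrow> (nat \<Rightarrow> vec) \<Rightarrow> nat \<Rightarrow> vec \<Rightarrow> real"
  where "chain_fun k d p lam \<gamma> b v n =
    ridge d p ({..<n} <+> {..<d}) (chain_profile k lam \<gamma> b) (chain_dir v) []"

lemma ridge_chain_cong:
  assumes "\<And>i. i < n \<Longrightarrow> v i = v' i"
  shows "ridge d p ({..<n} <+> {..<d}) \<phi> (chain_dir v) is x
    = ridge d p ({..<n} <+> {..<d}) \<phi> (chain_dir v') is x"
proof -
  have "chain_dir v r = chain_dir v' r" if "r \<in> {..<n} <+> {..<d}" for r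
  proof -
    consider "r = Inl 0" | i where "r = Inl (Suc i)" | l where "r = Inr l"
      by (metis sum.exhaust not0_implies_Suc)
    then show ?thesis
      using that assms by cases auto
  qed
  then show ?thesis
    unfolding ridge_def by (intro sum.cong) auto
qed

text \<open>The two functions differ by the link between \<open>v (n - 1)\<close> and
  \<open>v n\<close>. Its argument is 0 at \<open>x\<close>, where \<open>abs_power\<close> vanishes
  with all derivatives up to order \<open>k\<close>. For \<open>n = 0\<close> the added term would
  be the linear one, hence \<open>0 < n\<close>.\<close>

lemma oracle_response_chain_fun_Suc:
  assumes "0 < n" "ip d (v (n - 1)) (vdiff x p) = 0" "ip d (v n) (vdiff x p) = 0"
  shows "oracle_response d k (chain_fun k d p lam \<gamma> b v n) x
    = oracle_response d k (chain_fun k d p lam \<gamma> b v (Suc n)) x"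
proof -
  obtain m where m: "n = Suc m" using assms(1) by (cases n) auto
  have "ip d (chain_dir v (Inl n)) (vdiff x p) = 0"
    using assms by (simp add: m ip_diff_left[where z = "vdiff x p"])
  then have "chain_profile k lam \<gamma> b (Inl n) j (ip d (chain_dir v (Inl n)) (vdiff x p)) = 0" for j
    by (simp add: m abs_power_at_zero)
  then have "ridge d p ({..<n} <+> {..<d}) (chain_profile k lam \<gamma> b) (chain_dir v) is x
    = ridge d p ({..<Suc n} <+> {..<d}) (chain_profile k lam \<gamma> b) (chain_dir v) is x" for "is"
    unfolding ridge_def by (simp add: sum.Plus del: chain_dir.simps chain_profile.simps)
  then show ?thesis
    unfolding oracle_response_def chain_fun_def
    by (auto simp: nabla_ridge[OF derivatives_upto_chain_profile])
qed

section \<open>The adversary's choice of directions\<close>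

lemma query_cong:
  assumes "\<And>s. 1 \<le> s \<Longrightarrow> s < t \<Longrightarrow>
    oracle_response d k f (query d k \<A> f s) = oracle_response d k f' (query d k \<A> f s)"
  shows "query d k \<A> f t = query d k \<A> f' t"
  using assms
proof (induction t rule: less_induct)
  case (less t)
  \<comment> \<open>By induction the earlier queries coincide, so agreement of the responses along
    the run on \<open>f\<close> is enough.\<close>
  have "map (\<lambda>s. oracle_response d k f (query d k \<A> f s)) [1..<t]
      = map (\<lambda>s. oracle_response d k f' (query d k \<A> f' s)) [1..<t]"
    using less by (auto intro!: map_cong)
  then show ?case
    by (simp only: query.simps[of d k \<A> f t] query.simps[of d k \<A> f' t])
qed

text \<open>
  The vector \<open>v n\<close> is chosen after the query \<open>n + 1\<close>; the previous answers do not change, since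
  the new term of the chain vanishes to order \<open>k\<close> at the previous queries.
\<close>

lemma resisting_directions:
  assumes alg: "is_algorithm d \<A>" and "2 * n < d"
  shows "\<exists>v. orthonormal d n v \<and> (\<forall>j<n. v j \<in> Rd d) \<and>
    (\<forall>t j. 1 \<le> t \<longrightarrow> t \<le> Suc j \<longrightarrow> j < n \<longrightarrow>
      ip d (v j) (vdiff (query d k \<A> (chain_fun k d p lam \<gamma> b v n) t) p) = 0)"
  using assms(2)
proof (induction n)
  case 0
  show ?case by (simp add: orthonormal_def)
next
  case (Suc n)
  then obtain v where on: "orthonormal d n v" and v_in: "\<And>j. j < n \<Longrightarrow> v j \<in> Rd d"
    and orth: "\<And>t j. 1 \<le> t \<Longrightarrow> t \<le> Suc j \<Longrightarrow> j < n \<Longrightarrow>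
      ip d (v j) (vdiff (query d k \<A> (chain_fun k d p lam \<gamma> b v n) t) p) = 0"
    by fastforce
  define q where "q = query d k \<A> (chain_fun k d p lam \<gamma> b v n)"
  define a where "a = (\<lambda>r. case r of Inl j \<Rightarrow> v j | Inr t \<Rightarrow> vdiff (q t) p)"
  \<comment> \<open>The new direction has to avoid \<open>n\<close> old directions and
    \<open>n + 1\<close> queries, which is \<open>2 * n + 1\<close> linear conditions.\<close>
  have "card ({..<n} <+> {1..Suc n}) < d"
    using Suc.prems by (simp add: card_Plus)
  then obtain w where w: "w \<in> Rd d" "ip d w w = 1" "\<And>r. r \<in> {..<n} <+> {1..Suc n} \<Longrightarrow> ip d (a r) w = 0"
    using exists_unit_orthogonal[of "{..<n} <+> {1..Suc n}" d a] by auto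
  have wv: "ip d (v j) w = 0" if "j < n" for j
    using w(3)[OF InlI, of j] that by (simp add: a_def)
  have wq: "ip d w (vdiff (q t) p) = 0" if "1 \<le> t" "t \<le> Suc n" for t
    using w(3)[OF InrI, of t] that by (simp add: a_def ip_commute[of d w])
  define v' where "v' = v(n := w)"
  have v'_simps: "v' n = w" "\<And>j. j < n \<Longrightarrow> v' j = v j"
    by (auto simp: v'_def)
  have same: "chain_fun k d p lam \<gamma> b v n = chain_fun k d p lam \<gamma> b v' n"
    unfolding chain_fun_def using ridge_chain_cong[of n v v'] v'_simps by fastforce
  \<comment> \<open>Query \<open>t\<close> depends only on the responses at \<open>s < t\<close>,
    thus at \<open>s \<le> n\<close>. There \<open>v (n - 1)\<close> and the new \<open>w\<close>
    are both orthogonal to the displacement from \<open>p\<close>.\<close>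
  have q_eq: "q t = query d k \<A> (chain_fun k d p lam \<gamma> b v' (Suc n)) t" if "t \<le> Suc n" for t
    unfolding q_def same
  proof (rule query_cong)
    fix s assume s: "1 \<le> s" "s < t"
    have "ip d (v' (n - 1)) (vdiff (q s) p) = 0"
      using orth[of s "n - 1"] s that v'_simps(2)[of "n - 1"] by (simp add: q_def)
    moreover have "ip d (v' n) (vdiff (q s) p) = 0"
      using wq[of s] s that by (simp add: v'_simps)
    ultimately show "oracle_response d k (chain_fun k d p lam \<gamma> b v' n)
        (query d k \<A> (chain_fun k d p lam \<gamma> b v' n) s)
      = oracle_response d k (chain_fun k d p lam \<gamma> b v' (Suc n))
        (query d k \<A> (chain_fun k d p lam \<gamma> b v' n) s)"
      using s that unfolding q_def same by (intro oracle_response_chain_fun_Suc) auto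
  qed
  have "orthonormal d (Suc n) v'"
    using on w(2) wv wv[unfolded ip_commute[of d _ w]]
    by (auto simp: orthonormal_def less_Suc_eq v'_def)
  moreover have "\<forall>j<Suc n. v' j \<in> Rd d"
    using v_in w(1) by (auto simp: less_Suc_eq v'_def)
  moreover have "ip d (v' j) (vdiff (query d k \<A> (chain_fun k d p lam \<gamma> b v' (Suc n)) t) p) = 0"
    if "1 \<le> t" "t \<le> Suc j" "j < Suc n" for t j
  proof (cases "j = n")
    case True
    then show ?thesis using q_eq[of t] wq[of t] that by (simp add: v'_simps)
  next
    case False
    then show ?thesis using q_eq[of t] orth[of t j] that by (simp add: v'_simps q_def)
  qed
  ultimately show ?case by blast
qed

section \<open>Strong convexity and the Lipschitz constant of the chain function\<close>

lemma strongly_convex_chain_fun: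
  assumes "2 \<le> k" "\<And>i. Suc i < n \<Longrightarrow> 0 \<le> b i"
  shows "strongly_convex d lam (chain_fun k d p lam \<gamma> b v n)"
  unfolding strongly_convex_def chain_fun_def
proof (intro conjI ballI)
  show "times_differentiable d 2 (ridge d p ({..<n} <+> {..<d}) (chain_profile k lam \<gamma> b) (chain_dir v) [])"
    using assms(1) by (intro times_differentiable_ridge[OF _ derivatives_upto_chain_profile]) auto
next
  fix x w assume "x \<in> Rd d" "w \<in> Rd d"
  have "0 \<le> chain_profile k lam \<gamma> b (Inl i) 2 t" if "i < n" for i t
    using assms that abs_power_2_nonneg[of k t] by (cases i) auto
  \<comment> \<open>The linear term has no curvature and the links have nonnegative curvature; the
    coordinate axes contribute exactly the right multiple of the squared norm.\<close>
  then have "lam * (\<Sum>i<d. (w i)\<^sup>2) \<le>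
     (\<Sum>r\<in>{..<n} <+> {..<d}. chain_profile k lam \<gamma> b r 2 (ip d (chain_dir v r) (vdiff x p)) *
       (ip d (chain_dir v r) w)\<^sup>2)"
    by (auto simp: sum.Plus ip_chain_dir_Inr sum_distrib_left simp del: chain_dir.simps
        intro!: sum_nonneg)
  then show "lam * (\<Sum>i<d. (w i)\<^sup>2) \<le> (\<Sum>i<d. \<Sum>j<d. w i * nabla d 2 (ridge d p ({..<n} <+> {..<d})
      (chain_profile k lam \<gamma> b) (chain_dir v) []) x [i, j] * w j)"
    by (simp only: hessian_ridge[OF derivatives_upto_chain_profile assms(1)])
qed

text \<open>Each difference vector has norm \<open>sqrt 2\<close>. Keeping one square of
  \<open>ip d (?u i) z\<close> and bounding the other \<open>k - 1\<close> factors gives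
  \<open>sqrt 2 ^ (k - 1)\<close>; Bessel bounds the sum of the squares by 4. The product is the
  constant \<open>2 powr ((real k + 3) / 2)\<close>.\<close>

lemma sum_chain_differences_le:
  assumes on: "orthonormal d n v" and k: "2 \<le> k" and z: "enorm d z = 1"
  shows "(\<Sum>i<n - 1. \<bar>ip d (vdiff (v i) (v (Suc i))) \<delta>\<bar> * \<bar>ip d (vdiff (v i) (v (Suc i))) z\<bar> ^ k)
    \<le> 2 powr ((real k + 3) / 2) * enorm d \<delta>"
proof -
  let ?u = "\<lambda>i. vdiff (v i) (v (Suc i))"
  have nu: "enorm d (?u i) = sqrt 2" if "i < n - 1" for i
  proof -
    have "(enorm d (?u i))\<^sup>2 = 2"
      using on that unfolding orthonormal_def by (simp add: ip_self[symmetric] ip_diff_left ip_diff_right)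
    then show ?thesis by (metis enorm_nonneg real_sqrt_abs abs_of_nonneg)
  qed
  have "\<bar>ip d (?u i) \<delta>\<bar> * \<bar>ip d (?u i) z\<bar> ^ k
      \<le> sqrt 2 ^ (k - 1) * enorm d \<delta> * (ip d (?u i) z)\<^sup>2" if "i < n - 1" for i
  proof -
    have "\<bar>ip d (?u i) z\<bar> \<le> sqrt 2"
      using ip_abs_le[of d "?u i" z] z nu[OF that] by simp
    then have 1: "\<bar>ip d (?u i) z\<bar> ^ (k - 2) \<le> sqrt 2 ^ (k - 2)"
      by (intro power_mono) auto
    have 2: "\<bar>ip d (?u i) \<delta>\<bar> \<le> sqrt 2 * enorm d \<delta>"
      using ip_abs_le[of d "?u i" \<delta>] nu[OF that] by simp
    have "\<bar>ip d (?u i) \<delta>\<bar> * \<bar>ip d (?u i) z\<bar> ^ k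
        = (\<bar>ip d (?u i) \<delta>\<bar> * \<bar>ip d (?u i) z\<bar> ^ (k - 2)) * (ip d (?u i) z)\<^sup>2"
    proof -
      have "\<bar>ip d (?u i) z\<bar> ^ k = \<bar>ip d (?u i) z\<bar> ^ (k - 2) * \<bar>ip d (?u i) z\<bar>\<^sup>2"
        using k by (simp only: power_add[symmetric] le_add_diff_inverse2)
      then show ?thesis by (simp only: power2_abs mult.assoc)
    qed
    also have "\<dots> \<le> (sqrt 2 * enorm d \<delta> * sqrt 2 ^ (k - 2)) * (ip d (?u i) z)\<^sup>2"
      using 1 2 by (intro mult_right_mono mult_mono) (auto simp: enorm_nonneg)
    also have "\<dots> = sqrt 2 ^ (k - 1) * enorm d \<delta> * (ip d (?u i) z)\<^sup>2"
    proof -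
      have "k - 1 = Suc (k - 2)" using k by simp
      then show ?thesis by (simp only: power_Suc mult_ac)
    qed
    finally show ?thesis .
  qed
  then have "(\<Sum>i<n - 1. \<bar>ip d (?u i) \<delta>\<bar> * \<bar>ip d (?u i) z\<bar> ^ k)
      \<le> sqrt 2 ^ (k - 1) * enorm d \<delta> * (\<Sum>i<n - 1. (ip d (?u i) z)\<^sup>2)"
    unfolding sum_distrib_left by (intro sum_mono) auto
  also have "\<dots> \<le> sqrt 2 ^ (k - 1) * enorm d \<delta> * 4"
  proof (rule mult_left_mono)
    have sq: "(x - y)\<^sup>2 \<le> 2 * x\<^sup>2 + 2 * y\<^sup>2" for x y :: real
      using zero_le_power2[of "x + y"] by (simp add: power2_eq_square algebra_simps)
    have "(\<Sum>i<n - 1. (ip d (?u i) z)\<^sup>2)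
        \<le> (\<Sum>i<n - 1. 2 * (ip d (v i) z)\<^sup>2 + 2 * (ip d (v (Suc i)) z)\<^sup>2)"
      unfolding ip_diff_left by (intro sum_mono sq)
    also have "\<dots> = 2 * (\<Sum>i<n - 1. (ip d (v i) z)\<^sup>2) + 2 * (\<Sum>i\<in>Suc ` {..<n - 1}. (ip d (v i) z)\<^sup>2)"
      by (simp add: sum.distrib sum_distrib_left sum.reindex)
    also have "\<dots> \<le> 2 * (\<Sum>i<n. (ip d (v i) z)\<^sup>2) + 2 * (\<Sum>i<n. (ip d (v i) z)\<^sup>2)"
      by (intro add_mono mult_left_mono sum_mono2) auto
    also have "\<dots> \<le> 4"
      using bessel[OF on, of z] z by simp
    finally show "(\<Sum>i<n - 1. (ip d (?u i) z)\<^sup>2) \<le> 4" .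
  qed (simp add: enorm_nonneg)
  also have "sqrt 2 ^ (k - 1) * enorm d \<delta> * 4 = 2 powr ((real k + 3) / 2) * enorm d \<delta>"
  proof -
    have "sqrt 2 ^ (k - 1) = 2 powr (1/2 * real (k - 1))"
      by (simp add: powr_half_sqrt[symmetric] powr_realpow[symmetric] powr_powr)
    moreover have "(4::real) = 2 powr 2" by simp
    ultimately have "sqrt 2 ^ (k - 1) * 4 = 2 powr (1/2 * real (k - 1) + 2)"
      by (simp only: powr_add)
    also have "1/2 * real (k - 1) + 2 = (real k + 3) / 2"
      using k by (simp add: field_simps of_nat_diff)
    finally show ?thesis by simp
  qed
  finally show ?thesis .
qed

lemma lipschitz_nabla_chain_fun:
  assumes k: "2 \<le> k" and d: "0 < d" and on: "orthonormal d n v"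
    and b: "\<And>i. Suc i < n \<Longrightarrow> 0 \<le> b i" "\<And>i. Suc i < n \<Longrightarrow> b i \<le> \<beta>" and "0 \<le> \<beta>"
  shows "lipschitz_nabla d k (\<beta> * (fact k * 2 powr ((real k + 3) / 2))) (chain_fun k d p lam \<gamma> b v n)"
  unfolding lipschitz_nabla_def chain_fun_def
proof (intro ballI tensor_norm_ridge_diff_le[OF derivatives_upto_chain_profile d])
  fix x y z assume z: "enorm d z = 1"
  let ?u = "\<lambda>i. vdiff (v i) (v (Suc i))"
  let ?s = "\<lambda>r. (chain_profile k lam \<gamma> b r k (ip d (chain_dir v r) (vdiff x p))
     - chain_profile k lam \<gamma> b r k (ip d (chain_dir v r) (vdiff y p))) * ip d (chain_dir v r) z ^ k"
  \<comment> \<open>For \<open>k = 2\<close> the derivative of order \<open>k\<close> of the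
    quadratic profile is the constant \<open>lam\<close>, which cancels in the difference; for
    larger \<open>k\<close> it is 0.\<close>
  have Inr: "?s (Inr l) = 0" for l
    using k by simp
  have Inl0: "?s (Inl 0) = 0"
    using k by simp
  have "(\<Sum>r\<in>{..<n} <+> {..<d}. ?s r) = (\<Sum>i<n. ?s (Inl i))"
    by (simp add: sum.Plus Inr del: chain_dir.simps chain_profile.simps)
  also have "\<dots> = (\<Sum>i<n - 1. ?s (Inl (Suc i)))"
  proof (cases n)
    case (Suc m)
    show ?thesis
      unfolding Suc sum.lessThan_Suc_shift Inl0 by simp
  qed simp
  finally have eq: "(\<Sum>r\<in>{..<n} <+> {..<d}. ?s r) = (\<Sum>i<n - 1. ?s (Inl (Suc i)))" .
  have "\<bar>?s (Inl (Suc i))\<bar> \<le> \<beta> * fact k * (\<bar>ip d (?u i) (vdiff x y)\<bar> * \<bar>ip d (?u i) z\<bar> ^ k)"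
    if "i < n - 1" for i
  proof -
    let ?X = "ip d (?u i) (vdiff x p)" and ?Y = "ip d (?u i) (vdiff y p)"
    have "\<bar>?s (Inl (Suc i))\<bar> = b i * \<bar>abs_power k k ?X - abs_power k k ?Y\<bar> * \<bar>ip d (?u i) z\<bar> ^ k"
      using b(1)[of i] that by (simp add: right_diff_distrib[symmetric] abs_mult power_abs)
    also have "\<dots> \<le> \<beta> * (fact k * \<bar>?X - ?Y\<bar>) * \<bar>ip d (?u i) z\<bar> ^ k"
      using b[of i] that \<open>0 \<le> \<beta>\<close>
      by (intro mult_right_mono mult_mono abs_power_k_lipschitz) auto
    also have "?X - ?Y = ip d (?u i) (vdiff x y)"
      by (simp add: ip_diff_right)
    finally show ?thesis by (simp add: mult.assoc)
  qed
  then have "\<bar>\<Sum>i<n - 1. ?s (Inl (Suc i))\<bar>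
      \<le> (\<Sum>i<n - 1. \<beta> * fact k * (\<bar>ip d (?u i) (vdiff x y)\<bar> * \<bar>ip d (?u i) z\<bar> ^ k))"
    by (intro order_trans[OF sum_abs] sum_mono) auto
  also have "\<dots> \<le> \<beta> * fact k * (2 powr ((real k + 3) / 2) * enorm d (vdiff x y))"
    unfolding sum_distrib_left[symmetric] using \<open>0 \<le> \<beta>\<close>
    by (intro mult_left_mono sum_chain_differences_le[OF on k z]) auto
  finally show "\<bar>\<Sum>r\<in>{..<n} <+> {..<d}. ?s r\<bar> \<le> \<beta> * (fact k * 2 powr ((real k + 3) / 2)) * edist d x y"
    unfolding eq edist_def by (simp only: mult.assoc)
qed

section \<open>Summation by parts and the minimizer of the chain function\<close>

lemma sum_tails_telescope:
  fixes y w :: "nat \<Rightarrow> real"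
  shows "(\<Sum>i<m. (\<Sum>j\<in>{Suc i..<Suc m}. y j) * (w i - w (Suc i))) + (\<Sum>i<Suc m. y i * w i)
    = (\<Sum>i<Suc m. y i) * w 0"
proof (induction m)
  case (Suc m)
  have tail: "(\<Sum>j\<in>{Suc i..<Suc (Suc m)}. y j) = (\<Sum>j\<in>{Suc i..<Suc m}. y j) + y (Suc m)"
    if "i < Suc m" for i
    using that by simp
  have "(\<Sum>i<Suc m. (\<Sum>j\<in>{Suc i..<Suc (Suc m)}. y j) * (w i - w (Suc i)))
      = (\<Sum>i<Suc m. (\<Sum>j\<in>{Suc i..<Suc m}. y j) * (w i - w (Suc i)) + y (Suc m) * (w i - w (Suc i)))"
    by (intro sum.cong refl) (simp add: tail distrib_right)
  also have "\<dots> = (\<Sum>i<m. (\<Sum>j\<in>{Suc i..<Suc m}. y j) * (w i - w (Suc i))) + y (Suc m) * (w 0 - w (Suc m))"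
    by (simp only: sum.distrib sum_distrib_left[symmetric] sum_lessThan_telescope' sum.lessThan_Suc[of _ m])
      (simp add: sum_lessThan_telescope')
  finally show ?case
    using Suc.IH by (simp add: algebra_simps)
qed simp

text \<open>Each summand is compared with its value at \<open>xs\<close>: links lie above their
  tangents, while the linear and quadratic terms are expanded exactly. The first-order parts cancel,
  leaving the second-order part of the quadratic term.\<close>

lemma chain_fun_lower_bound:
  fixes p x :: vec
  assumes k: "2 \<le> k" and on: "orthonormal d n v" and "0 < n"
    and b: "\<And>i. Suc i < n \<Longrightarrow> 0 \<le> b i"
    and y: "\<And>i. Suc i < n \<Longrightarrow> y (Suc i) \<le> y i"
    and stationary: "\<And>i. Suc i < n \<Longrightarrow> b i * (y i - y (Suc i)) ^ k = lam * (\<Sum>j\<in>{Suc i..<n}. y j)"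
    and \<gamma>: "\<gamma> = lam * (\<Sum>i<n. y i)"
  defines "xs \<equiv> (\<lambda>l. p l + (\<Sum>i<n. y i * v i l))"
  shows "chain_fun k d p lam \<gamma> b v n xs + lam / 2 * (enorm d (vdiff x xs))\<^sup>2
    \<le> chain_fun k d p lam \<gamma> b v n x"
proof -
  obtain m where m: "n = Suc m" using \<open>0 < n\<close> by (cases n) auto
  define Y where "Y = (\<lambda>l. \<Sum>i<n. y i * v i l)"
  define \<delta> where "\<delta> = vdiff x xs"
  define w where "w = (\<lambda>i. ip d (v i) \<delta>)"
  have xs: "vdiff xs p = Y" by (simp add: xs_def Y_def)
  have x: "vdiff x p = (\<lambda>l. Y l - (- \<delta> l))" by (auto simp: xs_def Y_def \<delta>_def)
  have vY: "ip d (v i) Y = y i" if "i < n" for i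
    unfolding Y_def using on that by (rule orthonormal_ip_combination)
  have ipx: "ip d u (vdiff x p) = ip d u Y + ip d u \<delta>" for u
    unfolding x ip_diff_right using ip_scale_right[of d u "-1" \<delta>] by simp
  let ?P = "\<lambda>r x. chain_profile k lam \<gamma> b r 0 (ip d (chain_dir v r) (vdiff x p))"
  have F: "chain_fun k d p lam \<gamma> b v n x
      = ?P (Inl 0) x + (\<Sum>i<m. ?P (Inl (Suc i)) x) + (\<Sum>l<d. ?P (Inr l) x)" for x
    unfolding chain_fun_def ridge_def m
    by (simp add: sum.Plus sum.lessThan_Suc_shift[of _ m] del: chain_dir.simps chain_profile.simps sum.lessThan_Suc)
  have lin: "?P (Inl 0) x = ?P (Inl 0) xs - \<gamma> * w 0"
    unfolding ipx xs by (simp add: w_def algebra_simps)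
  have pow: "?P (Inl (Suc i)) x \<ge> ?P (Inl (Suc i)) xs + lam * ((\<Sum>j\<in>{Suc i..<Suc m}. y j) * (w i - w (Suc i)))"
    if "i < m" for i
  proof -
    let ?s = "y i - y (Suc i)" and ?t = "w i - w (Suc i)"
    have i: "Suc i < n" using that m by simp
    have s: "ip d (chain_dir v (Inl (Suc i))) Y = ?s" "ip d (chain_dir v (Inl (Suc i))) \<delta> = ?t"
      using i by (simp_all add: ip_diff_left vY w_def)
    have "abs_power k 0 (?s + ?t) \<ge> abs_power k 0 ?s + ?s ^ k * ?t"
      using abs_power_above_tangent[OF k, of ?s "?s + ?t"] abs_power_1_nonneg_arg[of ?s k] y[OF i] k by simp
    from mult_left_mono[OF this b[OF i]]
    have "b i * abs_power k 0 (?s + ?t) \<ge> b i * abs_power k 0 ?s + (b i * ?s ^ k) * ?t"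
      by (simp add: algebra_simps)
    then show ?thesis
      unfolding ipx xs s stationary[OF i] by (simp add: m mult.assoc)
  qed
  have quad: "?P (Inr l) x = ?P (Inr l) xs + lam * (Y l * \<delta> l) + lam / 2 * (\<delta> l * \<delta> l)" if "l < d" for l
    unfolding ipx xs ip_chain_dir_Inr[OF that] by (simp add: power2_eq_square field_simps)
  have "(\<Sum>i<n. y i * w i) = ip d Y \<delta>"
    unfolding Y_def ip_sum_left ip_scale_left w_def ..
  \<comment> \<open>Summation by parts turns the link tangents, whose slopes are the tail sums of
    \<open>y\<close>, and the quadratic cross term into a multiple of \<open>w 0\<close> alone,
    which the linear term offsets.\<close>
  then have zero: "lam * (\<Sum>i<m. (\<Sum>j\<in>{Suc i..<Suc m}. y j) * (w i - w (Suc i))) + lam * ip d Y \<delta> = \<gamma> * w 0"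
    using sum_tails_telescope[where m = m and y = y and w = w] unfolding \<gamma> m
    by (simp add: distrib_left[symmetric] mult.assoc)
  have "(\<Sum>i<m. ?P (Inl (Suc i)) x) \<ge> (\<Sum>i<m. ?P (Inl (Suc i)) xs)
      + lam * (\<Sum>i<m. (\<Sum>j\<in>{Suc i..<Suc m}. y j) * (w i - w (Suc i)))"
    unfolding sum_distrib_left[of lam] sum.distrib[symmetric] by (intro sum_mono pow) auto
  moreover have "(\<Sum>l<d. ?P (Inr l) x) = (\<Sum>l<d. ?P (Inr l) xs) + lam * ip d Y \<delta> + lam / 2 * ip d \<delta> \<delta>"
  proof -
    have "(\<Sum>l<d. ?P (Inr l) x)
        = (\<Sum>l<d. ?P (Inr l) xs + lam * (Y l * \<delta> l) + lam / 2 * (\<delta> l * \<delta> l))"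
      by (intro sum.cong refl quad) simp
    then show ?thesis
      by (simp only: sum.distrib sum_distrib_left[symmetric] ip_def[of d Y] ip_def[of d \<delta> \<delta>])
  qed
  ultimately show ?thesis
    unfolding F[of x] F[of xs] lin ip_self[symmetric] \<delta>_def[symmetric] using zero by linarith
qed

text \<open>This reduces the lower bound to the choice of a sequence \<open>y\<close> of minimizer
  coordinates.\<close>

lemma resisting_function:
  assumes k: "2 \<le> k" and lam: "0 < lam" and \<beta>: "0 < \<beta>" and n: "0 < n" and d: "2 * n < d"
    and alg: "is_algorithm d \<A>"
    and y0: "\<And>i. i < n \<Longrightarrow> 0 \<le> y i"
    and y: "\<And>i. Suc i < n \<Longrightarrow> y (Suc i) < y i"
    and tail: "\<And>i. Suc i < n \<Longrightarrow> lam * (\<Sum>j\<in>{Suc i..<n}. y j) \<le> \<beta> * (y i - y (Suc i)) ^ k"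
    and D: "(\<Sum>i<n. (y i)\<^sup>2) \<le> D\<^sup>2" "0 \<le> D"
    and \<epsilon>: "\<And>i. Suc i < n \<Longrightarrow> \<epsilon> < lam / 2 * (y i)\<^sup>2"
  shows "\<exists>f x_opt. strongly_convex d lam f \<and> times_differentiable d k f \<and>
    lipschitz_nabla d k (\<beta> * (fact k * 2 powr ((real k + 3) / 2))) f \<and> global_min d f x_opt \<and>
    edist d (query d k \<A> f 1) x_opt \<le> D \<and>
    (\<forall>T\<ge>1. f (query d k \<A> f T) - f x_opt \<le> \<epsilon> \<longrightarrow> n \<le> T)"
proof -
  \<comment> \<open>The first query precedes every response, so \<open>f\<close> may be centred at
    it without circularity.\<close>
  define p where "p = \<A> []"
  have q1: "query d k \<A> f 1 = p" for f
    unfolding query.simps[of d k \<A> f 1] p_def by simp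
  have p: "p \<in> Rd d" using alg by (simp add: p_def is_algorithm_def)
  \<comment> \<open>The weights are solved from stationarity at \<open>y\<close>; the hypothesis
    \<open>tail\<close> says precisely that they stay below \<open>\<beta>\<close>.\<close>
  define b where "b = (\<lambda>i. lam * (\<Sum>j\<in>{Suc i..<n}. y j) / (y i - y (Suc i)) ^ k)"
  define \<gamma> where "\<gamma> = lam * (\<Sum>i<n. y i)"
  have b: "0 \<le> b i" "b i \<le> \<beta>" "b i * (y i - y (Suc i)) ^ k = lam * (\<Sum>j\<in>{Suc i..<n}. y j)"
    if "Suc i < n" for i
  proof -
    have pos: "(y i - y (Suc i)) ^ k > 0" using y[OF that] by simp
    show "0 \<le> b i"
      unfolding b_def using lam pos y0 by (intro divide_nonneg_pos mult_nonneg_nonneg sum_nonneg) auto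
    show "b i \<le> \<beta>"
      unfolding b_def using tail[OF that] pos by (simp add: divide_le_eq)
    show "b i * (y i - y (Suc i)) ^ k = lam * (\<Sum>j\<in>{Suc i..<n}. y j)"
      unfolding b_def using y[OF that] by simp
  qed
  obtain v where on: "orthonormal d n v" and v_in: "\<And>j. j < n \<Longrightarrow> v j \<in> Rd d"
    and orth: "\<And>t j. 1 \<le> t \<Longrightarrow> t \<le> Suc j \<Longrightarrow> j < n \<Longrightarrow>
      ip d (v j) (vdiff (query d k \<A> (chain_fun k d p lam \<gamma> b v n) t) p) = 0"
    using resisting_directions[OF alg d] by blast
  define f where "f = chain_fun k d p lam \<gamma> b v n"
  define xs where "xs = (\<lambda>l. p l + (\<Sum>i<n. y i * v i l))"
  have xs_in: "xs \<in> Rd d"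
    using p v_in by (auto simp: xs_def topspace_Euclidean_space intro!: sum.neutral)
  have lower: "f xs + lam / 2 * (enorm d (vdiff x xs))\<^sup>2 \<le> f x" for x
    unfolding f_def xs_def using b y
    by (intro chain_fun_lower_bound[OF k on n]) (auto simp: \<gamma>_def less_imp_le)
  have "f xs \<le> f x" for x
    by (rule order_trans[OF _ lower[of x]]) (use lam in auto)
  then have "global_min d f xs"
    unfolding global_min_def using xs_in by blast
  moreover have "strongly_convex d lam f"
    unfolding f_def using b(1) by (intro strongly_convex_chain_fun k) auto
  moreover have "times_differentiable d k f"
    unfolding f_def chain_fun_def
    by (intro times_differentiable_ridge[OF _ derivatives_upto_chain_profile]) auto
  moreover have "lipschitz_nabla d k (\<beta> * (fact k * 2 powr ((real k + 3) / 2))) f"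
    unfolding f_def using b \<beta> d by (intro lipschitz_nabla_chain_fun[OF k _ on]) auto
  moreover have "edist d (query d k \<A> f 1) xs \<le> D"
  proof -
    have "vdiff p xs = (\<lambda>l. \<Sum>i<n. - y i * v i l)"
      by (simp add: xs_def sum_negf)
    then have "(edist d p xs)\<^sup>2 \<le> D\<^sup>2"
      using orthonormal_norm_combination[OF on, of "\<lambda>i. - y i"] D(1) by (simp add: edist_def)
    then show ?thesis
      unfolding q1 using D(2) by (rule power2_le_imp_le)
  qed
  moreover have "n \<le> T" if T: "1 \<le> T" "f (query d k \<A> f T) - f xs \<le> \<epsilon>" for T
  proof (rule ccontr)
    assume "\<not> n \<le> T"
    \<comment> \<open>Queries count from 1 and directions from 0: query \<open>T\<close> has no
      component along \<open>v (T - 1)\<close>, so it misses the coordinate \<open>y (T - 1)\<close>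
      of the minimizer.\<close>
    define i where "i = T - 1"
    have i: "Suc i < n" "T = Suc i" using T \<open>\<not> n \<le> T\<close> by (auto simp: i_def)
    let ?q = "query d k \<A> f T"
    have "ip d (v i) (vdiff ?q p) = 0"
      using orth[of T i] i by (simp add: f_def)
    moreover have "ip d (v i) (vdiff xs p) = y i"
      using orthonormal_ip_combination[OF on, of i y] i by (simp add: xs_def)
    ultimately have "ip d (v i) (vdiff ?q xs) = - y i"
      by (simp add: ip_diff_right)
    then have "(y i)\<^sup>2 = (ip d (v i) (vdiff ?q xs))\<^sup>2" by simp
    also have "\<dots> \<le> (\<Sum>j<n. (ip d (v j) (vdiff ?q xs))\<^sup>2)"
      using i by (intro member_le_sum) auto
    also have "\<dots> \<le> (enorm d (vdiff ?q xs))\<^sup>2"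
      by (rule bessel[OF on])
    finally have "lam / 2 * (y i)\<^sup>2 \<le> lam / 2 * (enorm d (vdiff ?q xs))\<^sup>2"
      using lam by (intro mult_left_mono) auto
    then show False
      using lower[of ?q] \<epsilon>[OF i(1)] T by linarith
  qed
  ultimately show ?thesis by blast
qed

subsection \<open>Coordinates of the minimizer\<close>

text \<open>Comparison with a geometric series; the induction needs the stronger bound with
  \<open>- 2 * y n\<close>.\<close>

lemma sum_halving_le:
  fixes y :: "nat \<Rightarrow> real"
  assumes "\<And>i. 0 \<le> y i" "\<And>i. y (Suc i) \<le> y i / 2"
  shows "(\<Sum>j\<in>{m..<n}. y j) \<le> 2 * y m"
proof (cases "m \<le> n")
  case True
  then have "(\<Sum>j\<in>{m..<n}. y j) \<le> 2 * y m - 2 * y n"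
  proof (induction n rule: dec_induct)
    case (step n)
    then show ?case using assms(2)[of n] by simp
  qed simp
  then show ?thesis using assms(1)[of n] by linarith
qed (use assms in simp)

text \<open>
  \<open>y i\<close> is the coordinate of the minimizer along \<open>v i\<close>. With \<open>a ^ (k - 1) = lam / \<beta>\<close> the third
  condition says that the weights \<open>b i\<close> making \<open>y\<close> stationary do not exceed \<open>\<beta>\<close>.
\<close>

definition admissible_minimizer :: "nat \<Rightarrow> real \<Rightarrow> real \<Rightarrow> nat \<Rightarrow> (nat \<Rightarrow> real) \<Rightarrow> bool" where
  "admissible_minimizer k a D n y \<longleftrightarrow> (\<forall>i<n. 0 \<le> y i) \<and> (\<forall>i. Suc i < n \<longrightarrow> y (Suc i) < y i) \<and>
     (\<forall>i. Suc i < n \<longrightarrow> a ^ (k - 1) * (\<Sum>j\<in>{Suc i..<n}. y j) \<le> (y i - y (Suc i)) ^ k) \<and>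
     (\<Sum>i<n. (y i)\<^sup>2) \<le> D\<^sup>2"

lemma power_pred_conv_powr:
  fixes x :: real
  assumes "0 < x" "2 \<le> k"
  shows "x ^ (k - 1) = x powr (real k - 1)"
proof -
  have "real k - 1 = real (k - 1)" using assms(2) by simp
  then show ?thesis using assms(1) by (simp only: powr_realpow)
qed

text \<open>With step \<open>a * h\<close> a tail sum is at most \<open>a * h * n ^ 2\<close>, so
  \<open>h ^ (k - 1) = n ^ 2\<close> meets the tail condition. The squared norm is at most
  \<open>a ^ 2 * h ^ 2 * n ^ 3\<close>, which explains the exponent of \<open>n\<close> in
  \<open>D\<close>.\<close>

lemma admissible_linear:
  fixes a D :: real
  assumes k: "2 \<le> k" and a: "0 < a" and n: "0 < n"
    and D: "a\<^sup>2 * real n powr ((3 * real k + 1) / (real k - 1)) \<le> D\<^sup>2"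
  shows "admissible_minimizer k a D n (\<lambda>i. a * real n powr (2 / (real k - 1)) * (real n - real i))"
proof -
  define h where "h = real n powr (2 / (real k - 1))"
  have h: "h > 0" using n by (simp add: h_def)
  have k1: "real k - 1 > 0" using k by auto
  have cancel: "2 / r * r = 2" if "r > 0" for r :: real
    using that by simp
  have hk: "h ^ (k - 1) = (real n)\<^sup>2"
  proof -
    have "h ^ (k - 1) = real n powr (2 / (real k - 1) * (real k - 1))"
      unfolding power_pred_conv_powr[OF h k] unfolding h_def by (rule powr_powr)
    also have "2 / (real k - 1) * (real k - 1) = 2"
      using cancel[OF k1] .
    also have "real n powr 2 = (real n)\<^sup>2"
      using n by simp
    finally show ?thesis .
  qed
  have tail: "a ^ (k - 1) * (\<Sum>j\<in>{Suc i..<n}. a * h * (real n - real j)) \<le> (a * h) ^ k" for i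
  proof -
    have "(\<Sum>j\<in>{Suc i..<n}. a * h * (real n - real j)) \<le> (\<Sum>j\<in>{Suc i..<n}. a * h * real n)"
      using a h by (intro sum_mono mult_left_mono) auto
    also have "\<dots> \<le> real n * (a * h * real n)"
      using a h by (auto intro!: mult_right_mono)
    finally have "a ^ (k - 1) * (\<Sum>j\<in>{Suc i..<n}. a * h * (real n - real j))
        \<le> a ^ (k - 1) * (real n * (a * h * real n))"
      using a by (intro mult_left_mono) auto
    also have "\<dots> = (a ^ (k - 1) * a) * (h ^ (k - 1) * h)"
      unfolding hk by (simp add: power2_eq_square)
    also have "\<dots> = (a * h) ^ k"
      using k by (simp add: power_Suc2[symmetric] power_mult_distrib del: power_Suc)
    finally show ?thesis .
  qed
  have "(\<Sum>i<n. (a * h * (real n - real i))\<^sup>2) \<le> (\<Sum>i<n. (a * h * real n)\<^sup>2)"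
    using a h by (intro sum_mono power_mono mult_left_mono) auto
  also have "\<dots> = a\<^sup>2 * (h\<^sup>2 * real n ^ 3)"
    by (simp add: power_mult_distrib power2_eq_square power3_eq_cube)
  also have "h\<^sup>2 * real n ^ 3 = real n powr (2 * (2 / (real k - 1)) + 3)"
  proof -
    have "h\<^sup>2 = h powr 2" "real n ^ 3 = real n powr 3" using h n by simp_all
    then show ?thesis
      unfolding powr_add by (simp only: h_def powr_powr mult.commute[of 2])
  qed
  also have "2 * (2 / (real k - 1)) + 3 = (3 * real k + 1) / (real k - 1)"
    using k1 by (simp add: field_simps)
  finally have "(\<Sum>i<n. (a * h * (real n - real i))\<^sup>2) \<le> D\<^sup>2"
    using D by linarith
  moreover have "a * h * (real n - real i) - a * h * (real n - real (Suc i)) = a * h" for i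
    by (simp add: algebra_simps)
  moreover have "a * h * (real n - real (Suc i)) < a * h * (real n - real i)" for i
    using a h by simp
  ultimately show ?thesis
    unfolding admissible_minimizer_def h_def[symmetric] using a h tail by auto
qed

text \<open>
  The factors \<open>16\<close> and \<open>1 / 32\<close> make \<open>y (i + 1)\<close> smaller than \<open>y i ^ k\<close> by enough to absorb the
  tail of the sequence.
\<close>

lemma admissible_superexponential:
  fixes a D :: real
  assumes k: "2 \<le> k" and a: "0 < a" "a \<le> D"
  shows "admissible_minimizer k a D n (\<lambda>i. 16 * a * (1 / 32) ^ (k ^ i))"
proof -
  define X :: "nat \<Rightarrow> real" where "X = (\<lambda>i. (1 / 32) ^ (k ^ i))"
  define y where "y = (\<lambda>i. 16 * a * X i)"
  have X: "0 < X i" "X i \<le> 1 / 32" for i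
    using power_decreasing[of 1 "k ^ i" "1 / 32 :: real"] k by (auto simp: X_def)
  have X_Suc: "X (Suc i) = X i ^ k" for i
    by (simp add: X_def power_mult[symmetric] mult.commute)
  have X_le: "X i ^ k \<le> X i / 32" for i
  proof -
    have "X i ^ k \<le> X i ^ 2"
      using X[of i] k by (intro power_decreasing) auto
    also have "\<dots> \<le> X i * (1 / 32)"
      unfolding power2_eq_square using X[of i] by (intro mult_left_mono) auto
    finally show ?thesis by simp
  qed
  have y0: "0 < y i" for i using X a by (simp add: y_def)
  have half: "y (Suc i) \<le> y i / 2" for i
    using mult_left_mono[OF X_le[of i], of "16 * a"] X(1)[of i] a y0[of i]
    by (simp add: y_def X_Suc)
  have "a ^ (k - 1) * (\<Sum>j\<in>{Suc i..<n}. y j) \<le> (y i - y (Suc i)) ^ k" for i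
  proof -
    \<comment> \<open>The tail is at most \<open>2 * y (Suc i)\<close>, that is
      \<open>32 * a * X i ^ k\<close>, while the gap is at least half of \<open>y i\<close>, that is
      \<open>8 * a * X i\<close>. Then \<open>32 \<le> 8 ^ k\<close> suffices.\<close>
    have "a ^ (k - 1) * (\<Sum>j\<in>{Suc i..<n}. y j) \<le> a ^ (k - 1) * (2 * y (Suc i))"
      using a y0 half by (intro mult_left_mono sum_halving_le) (auto intro: less_imp_le)
    also have "\<dots> = 32 * (a ^ (k - 1) * a * X i ^ k)"
      by (simp add: y_def X_Suc)
    also have "a ^ (k - 1) * a = a ^ k"
      using k by (simp add: power_Suc2[symmetric] del: power_Suc)
    also have "32 * (a ^ k * X i ^ k) \<le> 8 ^ k * (a ^ k * X i ^ k)"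
      using power_increasing[of 2 k "8 :: real"] k a X(1)[of i] by (intro mult_right_mono) auto
    also have "\<dots> = (8 * a * X i) ^ k"
      by (simp add: power_mult_distrib)
    also have "\<dots> \<le> (y i - y (Suc i)) ^ k"
      using a X(1)[of i] half[of i] by (intro power_mono) (auto simp: y_def)
    finally show ?thesis .
  qed
  moreover have "y (Suc i) < y i" for i
    using half[of i] y0[of i] by linarith
  moreover have "(\<Sum>i<n. (y i)\<^sup>2) \<le> D\<^sup>2"
  proof -
    have "y i \<le> a / 2" for i
      using X(2)[of i] a by (simp add: y_def)
    then have "(\<Sum>i<n. (y i)\<^sup>2) \<le> (\<Sum>i<n. a / 2 * y i)"
      unfolding power2_eq_square using y0 by (intro sum_mono mult_right_mono) (auto intro: less_imp_le)
    also have "\<dots> = a / 2 * (\<Sum>i\<in>{0..<n}. y i)"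
      by (simp add: sum_distrib_left atLeast0LessThan)
    also have "\<dots> \<le> a / 2 * (2 * y 0)"
      using a y0 half by (intro mult_left_mono sum_halving_le) (auto intro: less_imp_le)
    also have "\<dots> \<le> a\<^sup>2"
      by (simp add: y_def X_def power2_eq_square)
    also have "\<dots> \<le> D\<^sup>2"
      using a by (intro power_mono) auto
    finally show ?thesis .
  qed
  moreover have "0 \<le> y i" for i
    using y0 by (rule less_imp_le)
  ultimately have "admissible_minimizer k a D n y"
    unfolding admissible_minimizer_def by blast
  then show ?thesis
    by (simp only: y_def X_def)
qed

section \<open>Choosing the length of the chain\<close>

lemma exp_4_gt_32: "(32 :: real) < exp 4"
proof -
  have "(5 / 2 :: real) \<le> exp 1"
    using exp_lower_Taylor_quadratic[of "1 :: real"] by simp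
  then have "(5 / 2 :: real) ^ 4 \<le> exp 1 ^ 4" by (intro power_mono) auto
  then show ?thesis by (simp add: exp_of_nat_mult[symmetric] power_divide)
qed

text \<open>
  The linear sequence serves when the term in \<open>D\<close> dominates, the superexponential one when
  the term in \<open>\<epsilon>\<close> dominates.
\<close>

lemma exists_long_admissible:
  fixes a D lam \<epsilon> :: real
  assumes k: "2 \<le> k" and a: "0 < a" and lam: "0 < lam" and D: "sqrt 3 * a < D"
    and \<epsilon>: "0 < \<epsilon>" "\<epsilon> < lam * a\<^sup>2 / 8"
  shows "\<exists>n y. 0 < n \<and> ((D / (sqrt 3 * a)) ^ (k - 1)) powr (2 / (3 * real k + 1)) \<le> 2 * real n \<and>
    log (real k) (ln (lam * a\<^sup>2 / 2 * (1 / \<epsilon>))) \<le> 4 * real n \<and> admissible_minimizer k a D n y \<and>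
    (\<forall>i. Suc i < n \<longrightarrow> \<epsilon> < lam / 2 * (y i)\<^sup>2)"
proof -
  define E where "E = D / (sqrt 3 * a)"
  define X where "X = (E ^ (k - 1)) powr (2 / (3 * real k + 1))"
  define R where "R = lam * a\<^sup>2 / 2 * (1 / \<epsilon>)"
  define l where "l = log (real k) (ln R)"
  have k1: "real k - 1 > 0" using k by auto
  have sqrt3: "1 < sqrt 3" by simp
  have aD: "a < D"
    using mult_strict_right_mono[OF sqrt3 a] D by simp
  have E: "1 < E" using D a by (simp add: E_def)
  show ?thesis
  proof (cases "l \<le> 2 * X")
    case True
    have "1 \<le> X" unfolding X_def using E by (intro ge_one_powr_ge_zero) (auto intro: one_le_power)
    \<comment> \<open>Since \<open>X \<ge> 1\<close>, rounding down loses at most a factor 2, and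
      \<open>l \<le> 2 * X\<close> becomes \<open>l \<le> 4 * n\<close>.\<close>
    define n where "n = nat \<lfloor>X\<rfloor>"
    have "real n = of_int \<lfloor>X\<rfloor>" "1 \<le> n"
      using \<open>1 \<le> X\<close> by (simp_all add: n_def le_nat_floor)
    then have "1 \<le> n \<and> real n \<le> X \<and> X < real n + 1"
      by linarith
    then have n: "0 < n" "real n \<le> X" "X \<le> 2 * real n"
      by auto
    have "real n powr ((3 * real k + 1) / (real k - 1)) \<le> X powr ((3 * real k + 1) / (real k - 1))"
      using n k1 by (intro powr_mono2) auto
    also have "X = E powr ((real k - 1) * (2 / (3 * real k + 1)))"
      unfolding X_def using E k by (simp only: power_pred_conv_powr powr_powr)
    also have "\<dots> powr ((3 * real k + 1) / (real k - 1)) = E powr 2"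
    proof -
      have "r * (2 / s) * (s / r) = 2" if "r > 0" "s > 0" for r s :: real
        using that by simp
      from this[of "real k - 1" "3 * real k + 1"] show ?thesis
        unfolding powr_powr using k1 by simp
    qed
    also have "\<dots> = E\<^sup>2"
      using E by simp
    also have "\<dots> \<le> (D / a)\<^sup>2"
      unfolding E_def using a aD sqrt3 by (intro power_mono frac_le) auto
    finally have "a\<^sup>2 * real n powr ((3 * real k + 1) / (real k - 1)) \<le> a\<^sup>2 * (D / a)\<^sup>2"
      by (intro mult_left_mono) auto
    also have "\<dots> = D\<^sup>2" using a by (simp add: power_divide)
    finally have ok: "admissible_minimizer k a D n (\<lambda>i. a * real n powr (2 / (real k - 1)) * (real n - real i))"
      by (rule admissible_linear[OF k a n(1)])
    have "\<epsilon> < lam / 2 * (a * real n powr (2 / (real k - 1)) * (real n - real i))\<^sup>2" if "Suc i < n" for i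
    proof -
      \<comment> \<open>Every coordinate of the linear sequence is at least
        \<open>a\<close>.\<close>
      have "1 * 1 \<le> real n powr (2 / (real k - 1)) * (real n - real i)"
        using that k1 by (intro mult_mono ge_one_powr_ge_zero) auto
      from mult_left_mono[OF this, of a] have "a \<le> a * real n powr (2 / (real k - 1)) * (real n - real i)"
        using a by (simp add: mult.assoc)
      then have "lam / 2 * a\<^sup>2 \<le> lam / 2 * (a * real n powr (2 / (real k - 1)) * (real n - real i))\<^sup>2"
        using a lam by (intro mult_left_mono power_mono) auto
      moreover have "lam * a\<^sup>2 > 0" using a lam by simp
      ultimately show ?thesis using \<epsilon> by linarith
    qed
    moreover have "l \<le> 4 * real n" using True n by linarith
    ultimately show ?thesis
      using ok n unfolding E_def[symmetric] unfolding X_def[symmetric] R_def[symmetric] l_def[symmetric] by blast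
  next
    case False
    \<comment> \<open>The maximum with 1 keeps the chain nonempty; whenever \<open>Suc i < n\<close>
      the ceiling is the larger entry.\<close>
    define n where "n = max 1 (nat \<lceil>l / 4\<rceil>)"
    have "0 < n" by (simp add: n_def)
    moreover have "l \<le> 4 * real n" unfolding n_def by linarith
    ultimately have n: "0 < n" "l \<le> 4 * real n" by blast+
    have "\<epsilon> < lam / 2 * (16 * a * (1 / 32) ^ (k ^ i))\<^sup>2" if "Suc i < n" for i
    proof -
      \<comment> \<open>This puts \<open>i + 1\<close> below \<open>l / 4\<close>, hence
        \<open>i \<le> l - 3\<close>. The spare 3 divides \<open>k powr l = ln R\<close> by
        \<open>k ^ 3 \<ge> 8\<close>, which pays for comparing the square of
        \<open>32 ^ (k ^ i)\<close> with \<open>exp (8 * k ^ i)\<close>.\<close>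
      have "real (nat \<lceil>l / 4\<rceil>) \<ge> real i + 2"
        using that unfolding n_def by (auto simp: max_def split: if_splits)
      then have il: "real i \<le> l - 3" by linarith
      have "R > 0" unfolding R_def using lam a \<epsilon> by simp
      have "R > 4" unfolding R_def using \<epsilon> by (simp add: field_simps)
      then have lnR: "ln R > 0" by simp
      have "real (k ^ i) = real k powr real i"
        using k by (simp add: powr_realpow)
      also have "\<dots> \<le> real k powr (l - 3)"
        using k il by (intro powr_mono) auto
      also have "\<dots> = ln R / real k powr 3"
        using k lnR by (simp add: powr_diff l_def)
      also have "\<dots> \<le> ln R / 8"
      proof (intro divide_left_mono)
        have "(2 :: real) ^ 3 \<le> real k ^ 3" using k by (intro power_mono) auto
        then show "8 \<le> real k powr 3" using k by simp
      qed (use lnR k in auto)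
      finally have "8 * real (k ^ i) \<le> ln R" by simp
      then have "exp (8 * real (k ^ i)) \<le> R"
        using \<open>R > 0\<close> by (simp only: ln_ge_iff)
      moreover have "(32 ^ (k ^ i))\<^sup>2 < exp (8 * real (k ^ i))"
      proof -
        have "(32 :: real) ^ (2 * k ^ i) < exp 4 ^ (2 * k ^ i)"
          using exp_4_gt_32 k by (intro power_strict_mono) auto
        then show ?thesis
          by (simp add: exp_of_nat_mult[symmetric] power_mult[symmetric] mult_ac)
      qed
      ultimately have "(32 ^ (k ^ i))\<^sup>2 < R" by linarith
      then have "\<epsilon> * (32 ^ (k ^ i))\<^sup>2 < \<epsilon> * R"
        using \<epsilon>(1) by (rule mult_strict_left_mono)
      then have "\<epsilon> < \<epsilon> * R / (32 ^ (k ^ i))\<^sup>2"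
        by (subst less_divide_eq) simp
      also have "\<epsilon> * R = lam * a\<^sup>2 / 2" unfolding R_def using \<epsilon>(1) by simp
      also have "lam * a\<^sup>2 / 2 / (32 ^ (k ^ i))\<^sup>2 \<le> 256 * (lam * a\<^sup>2 / 2 / (32 ^ (k ^ i))\<^sup>2)"
      proof -
        have "0 \<le> lam * a\<^sup>2 / 2 / (32 ^ (k ^ i))\<^sup>2" using lam by simp
        then show ?thesis by linarith
      qed
      also have "\<dots> = lam / 2 * (16 * a * (1 / 32) ^ (k ^ i))\<^sup>2"
      proof -
        have "256 * (lam * a\<^sup>2 / 2 / z\<^sup>2) = lam / 2 * (16 * a * (1 / z))\<^sup>2" for z
          by (simp add: power2_eq_square)
        then show ?thesis unfolding power_one_over .
      qed
      finally show ?thesis .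
    qed
    moreover have "admissible_minimizer k a D n (\<lambda>i. 16 * a * (1 / 32) ^ (k ^ i))"
      using admissible_superexponential[OF k a] aD by simp
    moreover have "X \<le> 2 * real n" using False n by linarith
    ultimately show ?thesis
      using n unfolding E_def[symmetric] unfolding X_def[symmetric] R_def[symmetric] l_def[symmetric] by blast
  qed
qed

section \<open>Matching the parameters and constants of the lower bound\<close>

theorem theorem1:
  "\<exists>c>0. \<exists>C :: nat \<Rightarrow> real. (\<forall>k\<ge>2. C k > 0) \<and>
    (\<forall>k\<ge>2. \<forall>lam \<mu> D \<epsilon> :: real.
      lam > 0 \<longrightarrow> \<mu> > 0 \<longrightarrow> D > 0 \<longrightarrow> \<epsilon> > 0 \<longrightarrow>
      D > max
        (sqrt 3 * (fact k * 2 powr ((real k + 3) / 2) * lam / \<mu>) powr (1 / (real k - 1)))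
        (sqrt 3 * 12 powr ((3 * real k + 1) / (2 * (real k + 1)))
          * (fact k * 2 powr ((real k + 3) / 2) * lam / \<mu>) powr (5 / (4 * (2 * real k - 1)))) \<longrightarrow>
      \<epsilon> < min
        (((4 * fact k)^2 * lam ^ (k + 1) / \<mu>^2) powr (1 / (real k - 1)))
        (lam / 8 * (fact k * 2 powr ((real k + 3) / 2) * lam / \<mu>) powr (2 / (real k - 1))) \<longrightarrow>
      (\<exists>d\<^sub>0. \<forall>d\<ge>d\<^sub>0. \<forall>\<A>. is_algorithm d \<A> \<longrightarrow>
        (\<exists>f x_opt.
          strongly_convex d lam f \<and>
          times_differentiable d k f \<and> lipschitz_nabla d k \<mu> f \<and>
          global_min d f x_opt \<and> edist d (query d k \<A> f 1) x_opt \<le> D \<and>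
          (\<forall>T\<ge>1. f (query d k \<A> f T) - f x_opt \<le> \<epsilon> \<longrightarrow>
            real T \<ge> c *
              ((\<mu> * D ^ (k - 1)
                  / (3 powr ((real k - 1) / 2) * 2 powr ((real k + 3) / 2) * fact k * lam))
                powr (2 / (3 * real k + 1))
               + log (real k) (ln
                  (((4 * fact k)^2 * lam ^ (k + 1) / \<mu>^2) powr (1 / (real k - 1)) * (1 / \<epsilon>)))) \<and>
            (lam powr ((real k + 1) / (real k - 1)) / \<mu> powr (2 / (real k - 1)) * (1 / \<epsilon>) > 1 \<longrightarrow>
             real T \<ge> C k *
              ((\<mu> * D ^ (k - 1) / lam) powr (2 / (3 * real k + 1))
               + ln (ln (lam powr ((real k + 1) / (real k - 1)) / \<mu> powr (2 / (real k - 1))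
                   * (1 / \<epsilon>)))))))))"
proof -
  define P where "P k = (2 :: real) powr ((real k + 3) / 2)" for k :: nat
  \<comment> \<open>\<open>q k\<close> is the constant by which the polynomial term of the second
    bound exceeds that of the first. In \<open>C k\<close>, the part \<open>2 * q k\<close> comes
    from \<open>X \<le> 2 * n\<close> and \<open>4 * ln k\<close> from the bound
    \<open>4 * n\<close> on the logarithm to base \<open>k\<close>.\<close>
  define q where "q k = (3 powr ((real k - 1) / 2) * P k * fact k) powr (2 / (3 * real k + 1))" for k :: nat
  define C where "C k = 1 / (2 * q k + 4 * ln (real k))" for k :: nat
  have C_den: "2 * q k + 4 * ln (real k) > 0" if "2 \<le> k" for k
    using that by (intro add_nonneg_pos) (auto simp: q_def)
  show ?thesis
    unfolding P_def[symmetric]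
  \<comment> \<open>The two terms are at most \<open>2 * n\<close> and \<open>4 * n\<close>, so
    their sum is at most \<open>6 * n\<close>.\<close>
  proof (intro exI[of _ "1 / 6 :: real"] exI[of _ C] conjI allI impI)
    show "C k > 0" if "2 \<le> k" for k
      using C_den[OF that] by (simp add: C_def)
  next
    fix k :: nat and lam \<mu> D \<epsilon> :: real
    assume k: "2 \<le> k" and pos: "0 < lam" "0 < \<mu>" "0 < D" "0 < \<epsilon>"
      and D: "D > max (sqrt 3 * (fact k * P k * lam / \<mu>) powr (1 / (real k - 1)))
        (sqrt 3 * 12 powr ((3 * real k + 1) / (2 * (real k + 1)))
          * (fact k * P k * lam / \<mu>) powr (5 / (4 * (2 * real k - 1))))"
      and \<epsilon>: "\<epsilon> < min (((4 * fact k)^2 * lam ^ (k + 1) / \<mu>^2) powr (1 / (real k - 1)))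
        (lam / 8 * (fact k * P k * lam / \<mu>) powr (2 / (real k - 1)))"
    \<comment> \<open>\<open>L\<close> is \<open>lam / \<beta>\<close> for the largest weight
      \<open>\<beta>\<close> compatible with the Lipschitz constant \<open>\<mu>\<close>;
      \<open>a\<close> is its root of order \<open>k - 1\<close>.\<close>
    define L where "L = fact k * P k * lam / \<mu>"
    define a where "a = L powr (1 / (real k - 1))"
    define A where "A = ((4 * fact k)^2 * lam ^ (k + 1) / \<mu>^2) powr (1 / (real k - 1))"
    define B where "B = lam powr ((real k + 1) / (real k - 1)) / \<mu> powr (2 / (real k - 1))"
    define X where "X = (\<mu> * D ^ (k - 1) / (3 powr ((real k - 1) / 2) * P k * fact k * lam))
      powr (2 / (3 * real k + 1))"
    have k1: "real k - 1 > 0" using k by auto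
    have Ppos: "P k > 0" by (simp add: P_def)
    have Lpos: "L > 0" using pos Ppos by (simp add: L_def)
    have a: "a > 0" using Lpos by (simp add: a_def)
    have root: "(x ^ (k - 1)) powr (1 / (real k - 1)) = x" if "x > 0" for x
      unfolding power_pred_conv_powr[OF that k] powr_powr using that k1 by simp
    have aL: "a ^ (k - 1) = L"
      unfolding power_pred_conv_powr[OF a k] unfolding a_def powr_powr using k1 Lpos by simp
    have a2: "L powr (2 / (real k - 1)) = a\<^sup>2"
    proof -
      have "a\<^sup>2 = a powr 2" using a by simp
      then show ?thesis by (simp only: a_def powr_powr times_divide_eq_left mult_1)
    qed
    have PP: "(P k)\<^sup>2 = 2 ^ (k + 3)"
    proof -
      have "(P k)\<^sup>2 = 2 powr ((real k + 3) / 2 * 2)"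
        unfolding P_def by (simp only: powr_powr[symmetric] powr_numeral powr_ge_zero)
      also have "(real k + 3) / 2 * 2 = real (k + 3)" by simp
      finally show ?thesis by (simp only: powr_realpow zero_less_numeral)
    qed
    have \<mu>: "\<mu> = fact k * P k * lam / L"
      using pos Ppos by (simp add: L_def)
    \<comment> \<open>By \<open>PP\<close>, the base of the power in \<open>A\<close> is the
      \<open>(k - 1)\<close>-st power of \<open>lam * a\<^sup>2 / 2\<close>, so the iterated
      logarithm agrees with the one in \<open>exists_long_admissible\<close>.\<close>
    have A: "A = lam * a\<^sup>2 / 2"
    proof -
      obtain m where m: "k = Suc m" using k by (cases k) auto
      have "(4 * fact k)^2 * lam ^ (k + 1) / \<mu>^2 = 16 * lam ^ (k + 1) * L\<^sup>2 / ((P k)\<^sup>2 * lam\<^sup>2)"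
        unfolding \<mu> using pos Lpos Ppos by (simp add: power_mult_distrib power_divide field_simps)
      also have "\<dots> = lam ^ m * L\<^sup>2 / 2 ^ m"
        unfolding PP unfolding m using pos by (simp add: field_simps power_add power2_eq_square eval_nat_numeral)
      also have "\<dots> = (lam * a\<^sup>2 / 2) ^ (k - 1)"
        unfolding aL[symmetric] m by (simp add: power_mult_distrib power_divide power_mult[symmetric] mult.commute)
      finally show ?thesis
        unfolding A_def using root[of "lam * a\<^sup>2 / 2"] pos a by simp
    qed
    have X: "X = ((D / (sqrt 3 * a)) ^ (k - 1)) powr (2 / (3 * real k + 1))"
    proof -
      have s: "sqrt 3 ^ (k - 1) = 3 powr ((real k - 1) / 2)"
        using k by (simp add: power_pred_conv_powr powr_half_sqrt[symmetric] powr_powr del: One_nat_def)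
      have "(D / (sqrt 3 * a)) ^ (k - 1) = D ^ (k - 1) / (3 powr ((real k - 1) / 2) * L)"
        by (simp only: power_divide power_mult_distrib aL s)
      also have "\<dots> = \<mu> * D ^ (k - 1) / (3 powr ((real k - 1) / 2) * P k * fact k * lam)"
        unfolding L_def using pos Ppos by (simp add: field_simps)
      finally show ?thesis unfolding X_def by simp
    qed
    have aD: "sqrt 3 * a < D"
      using D unfolding L_def[symmetric] a_def by simp
    have \<epsilon>a: "\<epsilon> < lam * a\<^sup>2 / 8"
      using \<epsilon> unfolding L_def[symmetric] a2 by simp
    obtain n y where n: "0 < n" "X \<le> 2 * real n" "log (real k) (ln (A * (1 / \<epsilon>))) \<le> 4 * real n"
      and ok: "admissible_minimizer k a D n y" and y\<epsilon>: "\<And>i. Suc i < n \<Longrightarrow> \<epsilon> < lam / 2 * (y i)\<^sup>2"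
      using exists_long_admissible[OF k a pos(1) aD pos(4) \<epsilon>a] unfolding X A by blast
    define \<beta> where "\<beta> = lam / L"
    have \<beta>: "\<beta> > 0" "\<beta> * (fact k * P k) = \<mu>"
      using pos Lpos by (auto simp: \<beta>_def \<mu>)
    have tail: "lam * (\<Sum>j\<in>{Suc i..<n}. y j) \<le> \<beta> * (y i - y (Suc i)) ^ k" if "Suc i < n" for i
    proof -
      have "lam * (\<Sum>j\<in>{Suc i..<n}. y j) = \<beta> * (a ^ (k - 1) * (\<Sum>j\<in>{Suc i..<n}. y j))"
        unfolding aL \<beta>_def using Lpos by simp
      also have "\<dots> \<le> \<beta> * (y i - y (Suc i)) ^ k"
        using ok that \<beta>(1) unfolding admissible_minimizer_def by (intro mult_left_mono) auto
      finally show ?thesis .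
    qed
    have bound1: "1 / 6 * (X + log (real k) (ln (A * (1 / \<epsilon>)))) \<le> real T" if "n \<le> T" for T
    proof -
      have "X + log (real k) (ln (A * (1 / \<epsilon>))) \<le> 2 * real n + 4 * real n"
        using n(2,3) by (rule add_mono)
      moreover have "real n \<le> real T" using that by simp
      ultimately show ?thesis by simp
    qed
    have bound2: "C k * ((\<mu> * D ^ (k - 1) / lam) powr (2 / (3 * real k + 1)) + ln (ln (B * (1 / \<epsilon>)))) \<le> real T"
      if "n \<le> T" and B1: "B * (1 / \<epsilon>) > 1" for T
    proof -
      have nT: "real n \<le> real T" using that by simp
      have Xq: "(\<mu> * D ^ (k - 1) / lam) powr (2 / (3 * real k + 1)) = q k * X"
      proof -
        have "\<mu> * D ^ (k - 1) / lam = (3 powr ((real k - 1) / 2) * P k * fact k) *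
            (\<mu> * D ^ (k - 1) / (3 powr ((real k - 1) / 2) * P k * fact k * lam))"
          using Ppos by simp
        also have "\<dots> powr (2 / (3 * real k + 1)) = q k * X"
          unfolding q_def X_def by (rule powr_mult)
        finally show ?thesis .
      qed
      have "q k * X \<le> q k * (2 * real T)"
        using n(2) nT by (intro mult_left_mono) (auto simp: q_def)
      moreover have "ln (ln (B * (1 / \<epsilon>))) \<le> 4 * ln (real k) * real T"
      proof -
        have "B = (lam ^ (k + 1) / \<mu>\<^sup>2) powr (1 / (real k - 1))"
        proof -
          have "lam ^ (k + 1) = lam powr real (k + 1)" "\<mu>\<^sup>2 = \<mu> powr 2"
            using pos by (simp_all only: powr_realpow powr_numeral less_imp_le)
          then show ?thesis
            unfolding B_def powr_divide by (simp add: powr_powr add.commute del: powr_numeral)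
        qed
        \<comment> \<open>\<open>B\<close> is \<open>A\<close> without the factor
          \<open>(4 * fact k)^2\<close>, which is at least 1. The assumption \<open>B1\<close> then
          makes the inner logarithm positive, so the outer one is monotone.\<close>
        also have "\<dots> \<le> A"
          unfolding A_def using pos k1 fact_ge_1[of k, where 'a = real]
          by (intro powr_mono2 divide_right_mono) (auto simp: power_mult_distrib intro!: mult_ge1_I one_le_power)
        finally have "B * (1 / \<epsilon>) \<le> A * (1 / \<epsilon>)"
          using pos by (intro mult_right_mono) auto
        then have "ln (ln (B * (1 / \<epsilon>))) \<le> ln (ln (A * (1 / \<epsilon>)))"
          using B1 by (simp del: times_divide_eq_right)
        also have "\<dots> = ln (real k) * log (real k) (ln (A * (1 / \<epsilon>)))"
          using k by (simp add: log_def)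
        also have "\<dots> \<le> ln (real k) * (4 * real T)"
          using n(3) nT k by (intro mult_left_mono) auto
        finally show ?thesis by simp
      qed
      ultimately have "q k * X + ln (ln (B * (1 / \<epsilon>))) \<le> real T * (2 * q k + 4 * ln (real k))"
        by (simp add: algebra_simps)
      then show ?thesis
        unfolding Xq C_def using C_den[OF k] by (simp add: pos_divide_le_eq del: times_divide_eq_right)
    qed
    have "\<exists>f x_opt. strongly_convex d lam f \<and> times_differentiable d k f \<and> lipschitz_nabla d k \<mu> f \<and>
        global_min d f x_opt \<and> edist d (query d k \<A> f 1) x_opt \<le> D \<and>
        (\<forall>T\<ge>1. f (query d k \<A> f T) - f x_opt \<le> \<epsilon> \<longrightarrow> n \<le> T)"
      if "2 * n < d" "is_algorithm d \<A>" for d \<A>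
      using resisting_function[OF k pos(1) \<beta>(1) n(1) that, of y D \<epsilon>] ok tail y\<epsilon> pos
      unfolding admissible_minimizer_def P_def[of k, symmetric] \<beta>(2) by simp
    then show "\<exists>d\<^sub>0. \<forall>d\<ge>d\<^sub>0. \<forall>\<A>. is_algorithm d \<A> \<longrightarrow>
        (\<exists>f x_opt. strongly_convex d lam f \<and> times_differentiable d k f \<and> lipschitz_nabla d k \<mu> f \<and>
          global_min d f x_opt \<and> edist d (query d k \<A> f 1) x_opt \<le> D \<and>
          (\<forall>T\<ge>1. f (query d k \<A> f T) - f x_opt \<le> \<epsilon> \<longrightarrow>
            real T \<ge> 1 / 6 *
              ((\<mu> * D ^ (k - 1) / (3 powr ((real k - 1) / 2) * P k * fact k * lam))
                powr (2 / (3 * real k + 1))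
               + log (real k) (ln
                  (((4 * fact k)^2 * lam ^ (k + 1) / \<mu>^2) powr (1 / (real k - 1)) * (1 / \<epsilon>)))) \<and>
            (lam powr ((real k + 1) / (real k - 1)) / \<mu> powr (2 / (real k - 1)) * (1 / \<epsilon>) > 1 \<longrightarrow>
             real T \<ge> C k *
              ((\<mu> * D ^ (k - 1) / lam) powr (2 / (3 * real k + 1))
               + ln (ln (lam powr ((real k + 1) / (real k - 1)) / \<mu> powr (2 / (real k - 1))
                   * (1 / \<epsilon>)))))))"
      unfolding A_def[symmetric] B_def[symmetric] X_def[symmetric]
      \<comment> \<open>The adversary needs \<open>2 * n < d\<close>, which fixes the threshold
        dimension.\<close>
      using bound1 bound2 by (intro exI[of _ "Suc (2 * n)"]) (meson Suc_le_lessD)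
  qed simp
qed

end
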